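(* Let $F$ be a field of characteristic zero, $G$ a finite abelian group, and $g,h$ distinct elements of $G\setminus\{1\}$ with $gh\ne1$. Below $r$ ranges over $G\setminus\{1,g,h,gh\}$ and $x_{1,r}$ stands for each of $x_{1,r}^+$ and $x_{1,r}^-$. Then: 1) $\mathrm{Id}^{\sharp}(W_{\nu_1}^{g,h})=\langle x_{1,1}^-,\ x_{1,s}^-,\ x_{1,s}^+x_{2,s}^+,\ x_{1,g}^+x_{2,gh}^+,\ x_{1,h}^+x_{2,gh}^+,\ x_{1,r}\mid s\in\{g,h,gh\}\rangle_{T_G^*}$. 2) $\mathrm{Id}^{\sharp}(W_{\nu_2}^{g,h})=\langle x_{1,1}^-,\ x_{1,g}^+,\ x_{1,h}^+,\ x_{1,gh}^-,\ x_{1,g}^-x_{2,g}^-,\ x_{1,h}^-x_{2,h}^-,\ x_{1,gh}^+x_{2,gh}^+,\ x_{1,g}^-x_{2,gh}^+,\ x_{1,h}^-x_{2,gh}^+,\ x_{1,r}\rangle_{T_G^*}$. 3) $\mathrm{Id}^{\sharp}(W_{\nu_3}^{g,h})=\langle x_{1,1}^-,\ x_{1,g}^+,\ x_{1,h}^-,\ x_{1,gh}^+,\ x_{1,g}^-x_{2,g}^-,\ x_{1,h}^+x_{2,h}^+,\ x_{1,gh}^-x_{2,gh}^-,\ x_{1,g}^-x_{2,gh}^-,\ x_{1,h}^+x_{2,gh}^-,\ x_{1,r}\rangle_{T_G^*}$. Moreover, for every $n\ge2$: 4) $\mathcal{X}_n(W_{\nu_1}^{g,h})=(\chi_{((n)_{1^+})};\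 \chi_{((n-1)_{1^+},(1)_{g^+})};\ \chi_{((n-1)_{1^+},(1)_{h^+})};\ \chi_{((n-1)_{1^+},(1)_{gh^+})};\ \chi_{((n-2)_{1^+},(1)_{g^+},(1)_{h^+})})$. 5) $\mathcal{X}_n(W_{\nu_2}^{g,h})=(\chi_{((n)_{1^+})};\ \chi_{((n-1)_{1^+},(1)_{g^-})};\ \chi_{((n-1)_{1^+},(1)_{h^-})};\ \chi_{((n-1)_{1^+},(1)_{gh^+})};\ \chi_{((n-2)_{1^+},(1)_{g^-},(1)_{h^-})})$. 6) $\mathcal{X}_n(W_{\nu_3}^{g,h})=(\chi_{((n)_{1^+})};\ \chi_{((n-1)_{1^+},(1)_{g^-})};\ \chi_{((n-1)_{1^+},(1)_{h^+})};\ \chi_{((n-1)_{1^+},(1)_{gh^-})};\ \chi_{((n-2)_{1^+},(1)_{g^-},(1)_{h^+})})$. 7) $c_n^{\sharp}(W_{\nu_i}^{g,h})=1+3n+2\binom n2$ and $l_n^{\sharp}(W_{\nu_i}^{g,h})=5$ for $i=1,2,3$.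
   Context: **General setting.** $G$ is a finite abelian group of order $t$ with unit $1$. A $(G,* )$-algebra is an associative $F$-algebra $A=\bigoplus_{g\in G}A_g$ with $A_gA_h\subseteq A_{gh}$ and an involution $*$ with $A_g^*=A_g$ for all $g$; $A_g^{\pm}=\{a\in A_g:a^*=\pm a\}$. The free $(G,* )$-algebra $\mathcal F$ is the free associative algebra on variables $x_{i,g}^+$ and $x_{i,g}^-$ ($i\ge1$, $g\in G$), of degree $g$, with involution determined by $(x_{i,g}^{\pm})^*=\pm x_{i,g}^{\pm}$. A polynomial is a $(G,* )$-identity of $A$ if it vanishes whenever each $x_{i,g}^{\varepsilon}$ is replaced by an element of $A_g^{\varepsilon}$; $\mathrm{Id}^{\sharp}(A)$ is the set of these identities. A $T_G^*$-ideal is an ideal of $\mathcal F$ invariant under all endomorphisms of $\mathcal F$ that preserve the grading and commute with $*$ (and, as all ideals $\mathrm{Id}^{\sharp}(A)$ are, invariant under $*$); $\langle S\rangle_{T_G^*}$ is the $T_G^*$-ideal generated by $S$. **Codimension, cocharacter, colength.** $P_n^{\sharp}=\mathrm{span}_F\{w_{\sigma(1)}\cdots w_{\sigma(n)}:\sigma\in S_n,\ w_i\in\{x_{i,g}^+,x_{i,g}^-\},\ g\in G\}$, $c_n^{\sharp}(A)=\dim_FP_n^{\sharp}/(P_n^{\sharp}\cap\mathrm{Id}^{\sharp}(A))$. With $G=\{g_1=1,\dots,g_t\}$ and $\langle n\rangle=(n_1,\dots,n_{2t})$, $\sum n_i=n$, $P_{\langle n\rangle}$ is the space of multilinear polynomials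 in $n_{2i-1}$ symmetric and $n_{2i}$ skew variables of degree $g_i$; $\chi_{\langle n\rangle}(A)$ is the character of the $S_{n_1}\times\cdots\times S_{n_{2t}}$-module $P_{\langle n\rangle}/(P_{\langle n\rangle}\cap\mathrm{Id}^{\sharp}(A))$ (each factor permutes the variables of one type). $l_n^{\sharp}(A)$ is the sum over all $\langle n\rangle$ with $\sum n_i=n$ of the number of irreducible constituents, with multiplicity, of $\chi_{\langle n\rangle}(A)$. The notation $\chi_{((\lambda)_{s^{\varepsilon}},(\mu)_{u^{\delta}},\dots)}$ denotes the irreducible character given by the outer tensor product in which $\lambda$ is the partition for the variables of degree $s$ and sign $\varepsilon$, $\mu$ the one for degree $u$ and sign $\delta$, etc., omitted partitions being empty ($gh^{\pm}$ means degree $gh$, sign $\pm$). The equality $\mathcal{X}_n(A)=(\chi;\chi';\dots)$ means that the nonzero characters $\chi_{\langle n\rangle}(A)$, over all $\langle n\rangle$ with $\sum n_i=n$, are exactly the listed ones. **Algebras.** $W=\mathrm{span}_F\{I_4,\ e_{12}+e_{34},\ e_{13}+e_{24},\ e_{14}\}\subset UT_4(F)$ (commutative). Involutions: $\nu_1$ is the identity; $\nu_2$ fixes $I_4,e_{14}$ and negates $e_{12}+e_{34}$ and $e_{13}+e_{24}$; $\nu_3$ fixes $I_4,e_{13}+e_{24}$ and negates $e_{12}+e_{34}$ and $e_{14}$. $W_{\nu_i}^{g,h}$ is $W$ with involution $\nu_i$ and $I_4,\ e_{12}+e_{34},\ e_{13}+e_{24},\ e_{14}$ homogeneous of degrees $1,g,h,gh$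 respectively. *)

theory Defs
  imports "HOL-Analysis.Analysis" "HOL-Library.Poly_Mapping"
begin

text \<open>
  The grading group is a type of class \<open>{finite, ab_group_add}\<close>, i.e. an arbitrary finite
  abelian group in additive notation: the unit is \<open>0\<close> and the product \<open>gh\<close> is \<open>g + h\<close>.
\<close>

section \<open>Linear algebra on finitely supported functions\<close>

definition pscale :: "'f::field \<Rightarrow> ('k \<Rightarrow>\<^sub>0 'f) \<Rightarrow> ('k \<Rightarrow>\<^sub>0 'f)"
  where "pscale c f = Poly_Mapping.map ((*) c) f"

lemma lookup_pscale [simp]: "Poly_Mapping.lookup (pscale c f) k = c * Poly_Mapping.lookup f k"
  by (simp add: pscale_def Poly_Mapping.map.rep_eq when_def)

global_interpretation pvs: vector_space "pscale :: 'f::field \<Rightarrow> ('k \<Rightarrow>\<^sub>0 'f) \<Rightarrow> ('k \<Rightarrow>\<^sub>0 'f)"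
  by unfold_locales (auto intro!: poly_mapping_eqI simp: lookup_add algebra_simps)

text \<open>Linear extension of a map between bases.\<close>
definition pushforward :: "('k \<Rightarrow> 'l) \<Rightarrow> ('k \<Rightarrow>\<^sub>0 'f::field) \<Rightarrow> ('l \<Rightarrow>\<^sub>0 'f)"
  where "pushforward \<phi> f =
    (\<Sum>k\<in>Poly_Mapping.keys f. Poly_Mapping.single (\<phi> k) (Poly_Mapping.lookup f k))"

text \<open>
  For subspaces \<open>Q \<subseteq> P\<close> with \<open>P/Q\<close> finite-dimensional, \<open>basis_mod P Q B\<close> says that the cosets
  \<open>b + Q\<close> of the elements \<open>b \<in> B\<close> form a basis of \<open>P/Q\<close>
  (uniqueness of the coordinates makes the cosets of distinct \<open>b\<close> distinct).
\<close>
definition is_coords_mod ::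
    "('k \<Rightarrow>\<^sub>0 'f::field) set \<Rightarrow> ('k \<Rightarrow>\<^sub>0 'f) set \<Rightarrow> ('k \<Rightarrow>\<^sub>0 'f) \<Rightarrow> (('k \<Rightarrow>\<^sub>0 'f) \<Rightarrow> 'f) \<Rightarrow> bool"
  where "is_coords_mod Q B p c \<longleftrightarrow>
    (\<forall>b. b \<notin> B \<longrightarrow> c b = 0) \<and> p - (\<Sum>b\<in>B. pscale (c b) b) \<in> Q"

definition basis_mod ::
    "('k \<Rightarrow>\<^sub>0 'f::field) set \<Rightarrow> ('k \<Rightarrow>\<^sub>0 'f) set \<Rightarrow> ('k \<Rightarrow>\<^sub>0 'f) set \<Rightarrow> bool"
  where "basis_mod P Q B \<longleftrightarrow> finite B \<and> B \<subseteq> P \<and> (\<forall>p\<in>P. \<exists>!c. is_coords_mod Q B p c)"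

text \<open>The dimension of \<open>P/Q\<close>.\<close>
definition quot_dim :: "('k \<Rightarrow>\<^sub>0 'f::field) set \<Rightarrow> ('k \<Rightarrow>\<^sub>0 'f) set \<Rightarrow> nat"
  where "quot_dim P Q = (THE d. \<exists>B. basis_mod P Q B \<and> card B = d)"

text \<open>The trace of the endomorphism of \<open>P/Q\<close> induced by an endomorphism \<open>T\<close> that preserves both.\<close>
definition quot_trace ::
    "('k \<Rightarrow>\<^sub>0 'f::field) set \<Rightarrow> ('k \<Rightarrow>\<^sub>0 'f) set \<Rightarrow> (('k \<Rightarrow>\<^sub>0 'f) \<Rightarrow> ('k \<Rightarrow>\<^sub>0 'f)) \<Rightarrow> 'f"
  where "quot_trace P Q T =
    (THE a. \<exists>B. basis_mod P Q B \<and> a = (\<Sum>b\<in>B. (THE c. is_coords_mod Q B (T b) c) b))"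


section \<open>Graded algebras with involution\<close>

datatype pm = Plus | Minus

instance pm :: finite
proof
  have "(UNIV :: pm set) = {Plus, Minus}" by (auto intro: pm.exhaust)
  then show "finite (UNIV :: pm set)" by (metis finite.emptyI finite_insert)
qed

fun pm_val :: "pm \<Rightarrow> 'r::ring_1" where
  "pm_val Plus = 1"
| "pm_val Minus = - 1"

record ('f, 'g, 'a) gstar_alg =
  scl :: "'f \<Rightarrow> 'a \<Rightarrow> 'a"
  mul :: "'a \<Rightarrow> 'a \<Rightarrow> 'a"
  unt :: 'a
  cmp :: "'g \<Rightarrow> 'a set"
  star :: "'a \<Rightarrow> 'a"

definition gcarrier :: "('f, 'g::finite, 'a::ab_group_add) gstar_alg \<Rightarrow> 'a set"
  where "gcarrier A = {\<Sum>g\<in>UNIV. a g | a. \<forall>g. a g \<in> cmp A g}"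

locale gstar_algebra = vector_space "scl A"
  for A :: "('f::field, 'g::{finite,ab_group_add}, 'a::ab_group_add) gstar_alg" +
  assumes subspace_cmp: "subspace (cmp A g)"
    and direct: "(\<And>g. a g \<in> cmp A g) \<Longrightarrow> (\<Sum>g\<in>UNIV. a g) = 0 \<Longrightarrow> a g = 0"
    and mul_cmp: "x \<in> cmp A g \<Longrightarrow> y \<in> cmp A h \<Longrightarrow> mul A x y \<in> cmp A (g + h)"
    and unt_cmp: "unt A \<in> cmp A 0"
    and star_cmp: "star A ` cmp A g = cmp A g"
    and mul_unt: "x \<in> gcarrier A \<Longrightarrow> mul A x (unt A) = x"
    and unt_mul: "x \<in> gcarrier A \<Longrightarrow> mul A (unt A) x = x"
    and mul_assoc: "x \<in> gcarrier A \<Longrightarrow> y \<in> gcarrier A \<Longrightarrow> z \<in> gcarrier A \<Longrightarrow>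
        mul A (mul A x y) z = mul A x (mul A y z)"
    and mul_add: "x \<in> gcarrier A \<Longrightarrow> y \<in> gcarrier A \<Longrightarrow> z \<in> gcarrier A \<Longrightarrow>
        mul A x (y + z) = mul A x y + mul A x z"
    and add_mul: "x \<in> gcarrier A \<Longrightarrow> y \<in> gcarrier A \<Longrightarrow> z \<in> gcarrier A \<Longrightarrow>
        mul A (x + y) z = mul A x z + mul A y z"
    and mul_scl: "x \<in> gcarrier A \<Longrightarrow> y \<in> gcarrier A \<Longrightarrow> mul A x (scl A c y) = scl A c (mul A x y)"
    and scl_mul: "x \<in> gcarrier A \<Longrightarrow> y \<in> gcarrier A \<Longrightarrow> mul A (scl A c x) y = scl A c (mul A x y)"
    and star_add: "x \<in> gcarrier A \<Longrightarrow> y \<in> gcarrier A \<Longrightarrow> star A (x + y) = star A x + star A y"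
    and star_scl: "x \<in> gcarrier A \<Longrightarrow> star A (scl A c x) = scl A c (star A x)"
    and star_mul: "x \<in> gcarrier A \<Longrightarrow> y \<in> gcarrier A \<Longrightarrow>
        star A (mul A x y) = mul A (star A y) (star A x)"
    and star_star: "x \<in> gcarrier A \<Longrightarrow> star A (star A x) = x"

text \<open>\<open>A\<^sub>g\<^sup>+\<close> and \<open>A\<^sub>g\<^sup>-\<close>.\<close>
fun pm_cmp :: "('f, 'g, 'a::ab_group_add) gstar_alg \<Rightarrow> 'g \<Rightarrow> pm \<Rightarrow> 'a set" where
  "pm_cmp A g Plus = {a \<in> cmp A g. star A a = a}"
| "pm_cmp A g Minus = {a \<in> cmp A g. star A a = - a}"


section \<open>The free algebra and its T-ideals\<close>

text \<open>
  The free algebra is the monoid algebra of the free monoid on the variables, with unit the empty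
  word (so \<open>\<langle>S\<rangle>\<close> is a T-ideal of the unital free algebra); the monoid product is
  written \<open>+\<close> because this is what the convolution product of \<open>poly_mapping\<close> expects.
\<close>
instantiation list :: (type) monoid_add
begin
definition zero_list :: "'a list" where "zero_list = []"
definition plus_list :: "'a list \<Rightarrow> 'a list \<Rightarrow> 'a list" where "plus_list = (@)"
instance by standard (simp_all add: zero_list_def plus_list_def)
end

text \<open>
  \<open>Var i g \<epsilon>\<close> is the variable with number \<open>i\<close>, degree \<open>g\<close> and sign \<open>\<epsilon>\<close>. Numbering starts at \<open>0\<close>:
  the variable written \<open>x\<^sub>i\<^sub>,\<^sub>g\<close> with \<open>i \<ge> 1\<close> on paper has number \<open>i - 1\<close>.
\<close>
datatype 'g var = Var (vnum: nat) (vdeg: 'g) (vsgn: pm)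

type_synonym ('f, 'g) free = "'g var list \<Rightarrow>\<^sub>0 'f"

definition X :: "nat \<Rightarrow> 'g \<Rightarrow> pm \<Rightarrow> ('f::field, 'g) free"
  where "X i g \<epsilon> = Poly_Mapping.single [Var i g \<epsilon>] 1"

definition free_cmp :: "'g::ab_group_add \<Rightarrow> ('f::field, 'g) free set"
  where "free_cmp g = {f. \<forall>w\<in>Poly_Mapping.keys f. sum_list (map vdeg w) = g}"

definition free_star :: "('f::field, 'g) free \<Rightarrow> ('f, 'g) free"
  where "free_star f = (\<Sum>w\<in>Poly_Mapping.keys f.
    Poly_Mapping.single (rev w) (prod_list (map (\<lambda>v. pm_val (vsgn v)) w) * Poly_Mapping.lookup f w))"

text \<open>The value of \<open>f\<close> at \<open>\<rho>\<close>; a constant term is sent to the corresponding multiple of the unit.\<close>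
definition free_eval ::
    "('f::field, 'g, 'a::ab_group_add) gstar_alg \<Rightarrow> ('g var \<Rightarrow> 'a) \<Rightarrow> ('f, 'g) free \<Rightarrow> 'a"
  where "free_eval A \<rho> f = (\<Sum>w\<in>Poly_Mapping.keys f.
    scl A (Poly_Mapping.lookup f w) (foldr (\<lambda>v. mul A (\<rho> v)) w (unt A)))"

definition Id_sharp :: "('f::field, 'g, 'a::ab_group_add) gstar_alg \<Rightarrow> ('f, 'g) free set"
  where "Id_sharp A =
    {f. \<forall>\<rho>. (\<forall>i g \<epsilon>. \<rho> (Var i g \<epsilon>) \<in> pm_cmp A g \<epsilon>) \<longrightarrow> free_eval A \<rho> f = 0}"

definition free_endo :: "(('f::field, 'g::ab_group_add) free \<Rightarrow> ('f, 'g) free) \<Rightarrow> bool"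
  where "free_endo \<phi> \<longleftrightarrow>
    Vector_Spaces.linear pscale pscale \<phi> \<and> \<phi> 1 = 1 \<and> (\<forall>p q. \<phi> (p * q) = \<phi> p * \<phi> q) \<and>
    (\<forall>g. \<phi> ` free_cmp g \<subseteq> free_cmp g) \<and> (\<forall>p. \<phi> (free_star p) = free_star (\<phi> p))"

definition T_ideal :: "('f::field, 'g::ab_group_add) free set \<Rightarrow> bool"
  where "T_ideal I \<longleftrightarrow>
    pvs.subspace I \<and> (\<forall>p\<in>I. \<forall>q. p * q \<in> I \<and> q * p \<in> I) \<and>
    free_star ` I \<subseteq> I \<and> (\<forall>\<phi>. free_endo \<phi> \<longrightarrow> \<phi> ` I \<subseteq> I)"

text \<open>\<open>T_ideal hull S\<close> is the T-ideal generated by \<open>S\<close>.\<close>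


section \<open>Codimensions\<close>

definition P_sharp :: "nat \<Rightarrow> ('f::field, 'g) free set"
  where "P_sharp n = pvs.span {Poly_Mapping.single w 1 | w.
    length w = n \<and> distinct (map vnum w) \<and> set (map vnum w) = {..<n}}"

definition codim :: "('f::field, 'g, 'a::ab_group_add) gstar_alg \<Rightarrow> nat \<Rightarrow> nat"
  where "codim A n = quot_dim (P_sharp n) (P_sharp n \<inter> Id_sharp A)"


section \<open>Irreducible characters of products of symmetric groups\<close>

text \<open>
  The symmetric group on \<open>n\<close> letters consists of the \<open>\<sigma>\<close> with \<open>\<sigma> permutes {..<n}\<close>; elements of its
  group algebra are of type \<open>(nat \<Rightarrow> nat) \<Rightarrow>\<^sub>0 'f\<close>. A partition is its list of parts.
\<close>
definition partitions :: "nat \<Rightarrow> nat list set"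
  where "partitions n = {p. sorted_wrt (\<ge>) p \<and> 0 \<notin> set p \<and> sum_list p = n}"

text \<open>
  Position of the entry \<open>k\<close> in the tableau of shape \<open>p\<close> filled with \<open>0, 1, 2, \<dots>\<close> row by row.
\<close>
definition tab_row :: "nat list \<Rightarrow> nat \<Rightarrow> nat"
  where "tab_row p k = (LEAST i. k < sum_list (take (Suc i) p))"

definition tab_col :: "nat list \<Rightarrow> nat \<Rightarrow> nat"
  where "tab_col p k = k - sum_list (take (tab_row p k) p)"

definition row_stab :: "nat list \<Rightarrow> (nat \<Rightarrow> nat) set"
  where "row_stab p =
    {\<sigma>. \<sigma> permutes {..<sum_list p} \<and> (\<forall>k<sum_list p. tab_row p (\<sigma> k) = tab_row p k)}"

definition col_stab :: "nat list \<Rightarrow> (nat \<Rightarrow> nat) set"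
  where "col_stab p =
    {\<tau>. \<tau> permutes {..<sum_list p} \<and> (\<forall>k<sum_list p. tab_col p (\<tau> k) = tab_col p k)}"

definition young_symmetrizer :: "nat list \<Rightarrow> ((nat \<Rightarrow> nat) \<Rightarrow>\<^sub>0 'f::field)"
  where "young_symmetrizer p =
    (\<Sum>\<sigma>\<in>row_stab p. \<Sum>\<tau>\<in>col_stab p. Poly_Mapping.single (\<sigma> \<circ> \<tau>) (of_int (sign \<tau>)))"

text \<open>The left ideal of the group algebra generated by the Young symmetrizer.\<close>
definition specht_module :: "nat list \<Rightarrow> ((nat \<Rightarrow> nat) \<Rightarrow>\<^sub>0 'f::field) set"
  where "specht_module p = pvs.span {pushforward ((\<circ>) \<pi>) (young_symmetrizer p) | \<pi>.
    \<pi> permutes {..<sum_list p}}"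

definition sym_char :: "nat list \<Rightarrow> (nat \<Rightarrow> nat) \<Rightarrow> 'f::field"
  where "sym_char p \<pi> = quot_trace (specht_module p) {0} (pushforward ((\<circ>) \<pi>))"

text \<open>
  A tuple \<open>\<langle>n\<rangle> = (n\<^sub>1, \<dots>, n\<^sub>2\<^sub>t)\<close> is a function on the types of variables, i.e. on pairs (degree, sign);
  likewise for tuples of partitions and for elements of \<open>S\<^sub>n\<^sub>1 \<times> \<dots> \<times> S\<^sub>n\<^sub>2\<^sub>t\<close>.
\<close>
definition sym_prod :: "('g \<times> pm \<Rightarrow> nat) \<Rightarrow> ('g \<times> pm \<Rightarrow> nat \<Rightarrow> nat) set"
  where "sym_prod \<nu> = {\<sigma>. \<forall>t. \<sigma> t permutes {..<\<nu> t}}"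

definition multipartitions :: "('g \<times> pm \<Rightarrow> nat) \<Rightarrow> ('g \<times> pm \<Rightarrow> nat list) set"
  where "multipartitions \<nu> = {\<Lambda>. \<forall>t. \<Lambda> t \<in> partitions (\<nu> t)}"

text \<open>Characters of \<open>sym_prod \<nu>\<close> are extended by \<open>0\<close> outside the group.\<close>
definition outer_char ::
    "('g::finite \<times> pm \<Rightarrow> nat list) \<Rightarrow> ('g \<times> pm \<Rightarrow> nat \<Rightarrow> nat) \<Rightarrow> 'f::field"
  where "outer_char \<Lambda> \<sigma> =
    (if \<sigma> \<in> sym_prod (\<lambda>t. sum_list (\<Lambda> t)) then \<Prod>t\<in>UNIV. sym_char (\<Lambda> t) (\<sigma> t) else 0)"

text \<open>
  The number of irreducible constituents, with multiplicity, of a character of \<open>sym_prod \<nu>\<close>: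
  the sum of the multiplicities \<open>m \<Lambda>\<close> in its decomposition into irreducible characters.
\<close>
definition num_constituents ::
    "('g::finite \<times> pm \<Rightarrow> nat) \<Rightarrow> (('g \<times> pm \<Rightarrow> nat \<Rightarrow> nat) \<Rightarrow> 'f::field) \<Rightarrow> nat"
  where "num_constituents \<nu> \<psi> = (THE k. \<exists>m.
    \<psi> = (\<lambda>\<sigma>. \<Sum>\<Lambda>\<in>multipartitions \<nu>. of_nat (m \<Lambda>) * outer_char \<Lambda> \<sigma>) \<and>
    k = (\<Sum>\<Lambda>\<in>multipartitions \<nu>. m \<Lambda>))"


section \<open>Cocharacters and colengths\<close>

definition P_type :: "('g \<times> pm \<Rightarrow> nat) \<Rightarrow> ('f::field, 'g) free set"
  where "P_type \<nu> = pvs.span {Poly_Mapping.single w 1 | w.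
    distinct w \<and> set w = {Var i g \<epsilon> | i g \<epsilon>. i < \<nu> (g, \<epsilon>)}}"

definition rename_var :: "('g \<times> pm \<Rightarrow> nat \<Rightarrow> nat) \<Rightarrow> 'g var \<Rightarrow> 'g var"
  where "rename_var \<sigma> v = Var (\<sigma> (vdeg v, vsgn v) (vnum v)) (vdeg v) (vsgn v)"

definition cochar ::
    "('f::field, 'g, 'a::ab_group_add) gstar_alg \<Rightarrow> ('g \<times> pm \<Rightarrow> nat) \<Rightarrow>
      ('g \<times> pm \<Rightarrow> nat \<Rightarrow> nat) \<Rightarrow> 'f"
  where "cochar A \<nu> \<sigma> =
    (if \<sigma> \<in> sym_prod \<nu>
     then quot_trace (P_type \<nu>) (P_type \<nu> \<inter> Id_sharp A) (pushforward (map (rename_var \<sigma>)))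
     else 0)"

definition types_of_size :: "nat \<Rightarrow> ('g::finite \<times> pm \<Rightarrow> nat) set"
  where "types_of_size n = {\<nu>. (\<Sum>t\<in>UNIV. \<nu> t) = n}"

definition colength :: "('f::field, 'g::finite, 'a::ab_group_add) gstar_alg \<Rightarrow> nat \<Rightarrow> nat"
  where "colength A n = (\<Sum>\<nu>\<in>types_of_size n. num_constituents \<nu> (cochar A \<nu>))"

text \<open>
  \<open>cochar_seq_eq A n L\<close> is the equality \<open>\<X>\<^sub>n(A) = (\<chi>\<^sub>\<Lambda>; \<dots>)\<close> with \<open>\<Lambda>\<close> running over \<open>L\<close>. Every character
  is paired with the tuple \<open>\<langle>n\<rangle>\<close> it belongs to.
\<close>
definition cochar_seq_eq ::
    "('f::field, 'g::finite, 'a::ab_group_add) gstar_alg \<Rightarrow> nat \<Rightarrow> ('g \<times> pm \<Rightarrow> nat list) set \<Rightarrow> bool"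
  where "cochar_seq_eq A n L \<longleftrightarrow>
    {(\<nu>, cochar A \<nu>) | \<nu>. \<nu> \<in> types_of_size n \<and> cochar A \<nu> \<noteq> (\<lambda>_. 0)} =
    {((\<lambda>t. sum_list (\<Lambda> t)), outer_char \<Lambda>) | \<Lambda>. \<Lambda> \<in> L}"

text \<open>The partition \<open>(m)\<close>, which is empty for \<open>m = 0\<close>.\<close>
definition one_row :: "nat \<Rightarrow> nat list"
  where "one_row m = (if m = 0 then [] else [m])"

abbreviation no_parts :: "'g \<times> pm \<Rightarrow> nat list"
  where "no_parts \<equiv> (\<lambda>_. [])"


section \<open>The algebra W\<close>

text \<open>In the index type \<open>4\<close> the numeral \<open>4\<close> equals \<open>0\<close>; \<open>1, 2, 3, 4\<close> are its four elements.\<close>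

type_synonym 'f mat4 = "'f ^ 4 ^ 4"

definition mscale :: "'f::field \<Rightarrow> 'f mat4 \<Rightarrow> 'f mat4"
  where "mscale c M = map_matrix ((*) c) M"

global_interpretation mvs: vector_space "mscale :: 'f::field \<Rightarrow> 'f mat4 \<Rightarrow> 'f mat4"
  by unfold_locales (simp_all add: mscale_def map_matrix_def vec_eq_iff algebra_simps)

definition munit :: "4 \<Rightarrow> 4 \<Rightarrow> 'f::field mat4"
  where "munit i j = (\<chi> a b. if a = i \<and> b = j then 1 else 0)"

definition W1 :: "'f::field mat4" where "W1 = munit 1 2 + munit 3 4"
definition W2 :: "'f::field mat4" where "W2 = munit 1 3 + munit 2 4"
definition W3 :: "'f::field mat4" where "W3 = munit 1 4"

text \<open>
  On \<open>\<alpha> I + \<beta> W1 + \<gamma> W2 + \<delta> W3\<close> the coefficients \<open>\<alpha>, \<beta>, \<gamma>, \<delta>\<close> are the entries of the first row.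
\<close>
definition nu1 :: "'f::field mat4 \<Rightarrow> 'f mat4"
  where "nu1 M = M"

definition nu2 :: "'f::field mat4 \<Rightarrow> 'f mat4"
  where "nu2 M = mscale (M$1$1) (mat 1) - mscale (M$1$2) W1 - mscale (M$1$3) W2 + mscale (M$1$4) W3"

definition nu3 :: "'f::field mat4 \<Rightarrow> 'f mat4"
  where "nu3 M = mscale (M$1$1) (mat 1) - mscale (M$1$2) W1 + mscale (M$1$3) W2 - mscale (M$1$4) W3"

definition W_alg ::
    "('f mat4 \<Rightarrow> 'f mat4) \<Rightarrow> 'g \<Rightarrow> 'g \<Rightarrow> ('f::field, 'g::ab_group_add, 'f mat4) gstar_alg"
  where "W_alg \<nu> g h =
    \<lparr> scl = mscale, mul = (**), unt = mat 1,
      cmp = (\<lambda>k. mvs.span {w. (w, k) \<in> {(mat 1, 0), (W1, g), (W2, h), (W3, g + h)}}),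
      star = \<nu> \<rparr>"

definition W_elt :: "'f::field \<Rightarrow> 'f \<Rightarrow> 'f \<Rightarrow> 'f \<Rightarrow> 'f mat4"
  where "W_elt a b c d = mscale a (mat 1) + mscale b W1 + mscale c W2 + mscale d W3"

lemma W_elt_entries: "W_elt a b c d = (\<chi> i j. if i = j then a
    else if i = 1 \<and> j = 2 \<or> i = 3 \<and> j = 4 then b
    else if i = 1 \<and> j = 3 \<or> i = 2 \<and> j = 4 then c
    else if i = 1 \<and> j = 4 then d else 0)"
  unfolding W_elt_def W1_def W2_def W3_def munit_def mscale_def mat_def
  by (simp add: vec_eq_iff forall_4)

lemma W_elt_inject [simp]:
  "W_elt a b c d = W_elt a' b' c' d' \<longleftrightarrow> a = a' \<and> b = b' \<and> c = c' \<and> d = d'"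
  unfolding W_elt_entries by (auto simp: vec_eq_iff forall_4)

lemma W_elt_add: "W_elt a b c d + W_elt a' b' c' d' = W_elt (a + a') (b + b') (c + c') (d + d')"
  unfolding W_elt_entries by (simp add: vec_eq_iff forall_4)

lemma W_elt_scale: "mscale k (W_elt a b c d) = W_elt (k * a) (k * b) (k * c) (k * d)"
  unfolding W_elt_entries mscale_def by (simp add: vec_eq_iff forall_4)

lemma W_elt_mult: "W_elt a b c d ** W_elt a' b' c' d' =
    W_elt (a * a') (a * b' + b * a') (a * c' + c * a') (a * d' + b * c' + c * b' + d * a')"
  unfolding W_elt_entries matrix_matrix_mult_def
  by (simp add: vec_eq_iff forall_4 sum_4)

lemma W_elt_basis:
  "mat 1 = W_elt 1 0 0 0" "W1 = W_elt 0 1 0 0" "W2 = W_elt 0 0 1 0" "W3 = W_elt 0 0 0 1"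
  "0 = W_elt 0 0 0 0"
  by (simp_all add: W_elt_def)

lemma nu_W_elt:
  "nu1 (W_elt a b c d) = W_elt a b c d"
  "nu2 (W_elt a b c d) = W_elt a (-b) (-c) d"
  "nu3 (W_elt a b c d) = W_elt a (-b) c (-d)"
  unfolding nu1_def nu2_def nu3_def
  by (simp_all add: W_elt_def W1_def W2_def W3_def munit_def mscale_def mat_def vec_eq_iff forall_4)

lemma W_cmp: "M \<in> cmp (W_alg \<nu> g h) k \<longleftrightarrow> (\<exists>a b c d. M = W_elt a b c d \<and>
    (a \<noteq> 0 \<longrightarrow> k = 0) \<and> (b \<noteq> 0 \<longrightarrow> k = g) \<and> (c \<noteq> 0 \<longrightarrow> k = h) \<and> (d \<noteq> 0 \<longrightarrow> k = g + h))"
  (is "_ \<longleftrightarrow> ?P M")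
proof
  let ?S = "{w. (w, k) \<in> {(mat 1, 0), (W1, g), (W2, h), (W3, g + h)}}"
  have cmp: "cmp (W_alg \<nu> g h) k = mvs.span ?S" by (simp add: W_alg_def)
  show "?P M" if "M \<in> cmp (W_alg \<nu> g h) k"
    using that unfolding cmp
  proof (induction rule: mvs.span_induct_alt)
    case base
    show ?case by (rule exI[of _ 0])+ (simp add: W_elt_basis)
  next
    case (step x w M)
    then obtain a b c d where M: "M = W_elt a b c d" "a \<noteq> 0 \<longrightarrow> k = 0" "b \<noteq> 0 \<longrightarrow> k = g"
      "c \<noteq> 0 \<longrightarrow> k = h" "d \<noteq> 0 \<longrightarrow> k = g + h" by blast
    from step(1) consider "w = mat 1" "k = 0" | "w = W1" "k = g" | "w = W2" "k = h"
      | "w = W3" "k = g + h" by blast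
    then have "?P w"
    proof cases
      case 1 show ?thesis by (rule exI[of _ 1], rule exI[of _ 0], rule exI[of _ 0], rule exI[of _ 0])
          (simp add: 1 W_elt_basis)
    next
      case 2 show ?thesis by (rule exI[of _ 0], rule exI[of _ 1], rule exI[of _ 0], rule exI[of _ 0])
          (simp add: 2 W_elt_basis)
    next
      case 3 show ?thesis by (rule exI[of _ 0], rule exI[of _ 0], rule exI[of _ 1], rule exI[of _ 0])
          (simp add: 3 W_elt_basis)
    next
      case 4 show ?thesis by (rule exI[of _ 0], rule exI[of _ 0], rule exI[of _ 0], rule exI[of _ 1])
          (simp add: 4 W_elt_basis)
    qed
    then obtain a' b' c' d' where w: "w = W_elt a' b' c' d'" "a' \<noteq> 0 \<longrightarrow> k = 0" "b' \<noteq> 0 \<longrightarrow> k = g"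
      "c' \<noteq> 0 \<longrightarrow> k = h" "d' \<noteq> 0 \<longrightarrow> k = g + h" by blast
    have "mscale x w + M = W_elt (x * a' + a) (x * b' + b) (x * c' + c) (x * d' + d)"
      by (simp add: M w W_elt_add W_elt_scale)
    moreover have "x * a' + a \<noteq> 0 \<longrightarrow> k = 0" "x * b' + b \<noteq> 0 \<longrightarrow> k = g"
      "x * c' + c \<noteq> 0 \<longrightarrow> k = h" "x * d' + d \<noteq> 0 \<longrightarrow> k = g + h"
      using M w by auto
    ultimately show ?case by blast
  qed
  show "M \<in> cmp (W_alg \<nu> g h) k" if "?P M"
  proof -
    from that obtain a b c d where M: "M = W_elt a b c d" "a \<noteq> 0 \<longrightarrow> k = 0" "b \<noteq> 0 \<longrightarrow> k = g"
      "c \<noteq> 0 \<longrightarrow> k = h" "d \<noteq> 0 \<longrightarrow> k = g + h" by blast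
    have sc: "mscale x w \<in> mvs.span ?S" if "x \<noteq> 0 \<longrightarrow> w \<in> ?S" for x w
      by (cases "x = 0") (use that in \<open>auto intro: mvs.span_scale mvs.span_base mvs.span_zero\<close>)
    show ?thesis unfolding cmp M(1) W_elt_def
      by (intro mvs.span_add sc) (use M in auto)
  qed
qed

lemma W_carrier:
  assumes "M \<in> gcarrier (W_alg \<nu> g h :: ('f::field, 'g::{finite,ab_group_add}, 'f mat4) gstar_alg)"
  obtains a b c d where "M = W_elt a b c d"
proof -
  from assms obtain m where m: "M = (\<Sum>k\<in>UNIV. m k)"
    "\<forall>k. m k \<in> cmp (W_alg \<nu> g h :: ('f, 'g, 'f mat4) gstar_alg) k"
    by (auto simp: gcarrier_def)
  have "\<exists>a b c d. (\<Sum>k\<in>A. m k) = W_elt a b c d" if "finite A" for A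
    using that
  proof (induction A)
    case empty
    show ?case by (rule exI[of _ 0])+ (simp add: W_elt_basis)
  next
    case (insert k A)
    then show ?case using m(2)[rule_format, of k] unfolding W_cmp
      by (fastforce simp: W_elt_add)
  qed
  from this[of UNIV] m that show thesis by auto
qed

theorem gstar_algebra_W:
  fixes g h :: "'g::{finite,ab_group_add}" and \<nu> :: "'f::field mat4 \<Rightarrow> 'f mat4"
  assumes \<nu>: "\<nu> \<in> {nu1, nu2, nu3}"
  shows "gstar_algebra (W_alg \<nu> g h)"
proof -
  let ?A = "W_alg \<nu> g h"
  have ops [simp]: "scl ?A = mscale" "mul ?A = (**)" "unt ?A = mat 1" "star ?A = \<nu>"
    by (simp_all add: W_alg_def)
  obtain s t u :: 'f where stu: "s * s = 1" "t * t = 1" "s * t = u"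
      and nu: "\<And>a b c d. \<nu> (W_elt a b c d) = W_elt a (s * b) (t * c) (u * d)"
  proof -
    consider "\<nu> = nu1" | "\<nu> = nu2" | "\<nu> = nu3" using \<nu> by auto
    then show thesis
      by cases (use that[of 1 1 1] that[of "-1" "-1" 1] that[of "-1" 1 "-1"] in
          \<open>simp_all add: nu_W_elt\<close>)
  qed
  have u: "u * u = 1" using stu by (metis mult.left_commute mult.assoc mult_1_right)
  show ?thesis
  proof (intro_locales)
    show "vector_space (scl ?A)" by (simp add: mvs.vector_space_axioms)
    show "gstar_algebra_axioms ?A"
    proof
      fix k show "module.subspace (scl ?A) (cmp ?A k)" by (simp add: W_alg_def)
    next
      fix m :: "'g \<Rightarrow> 'f mat4" and k
      assume m: "\<And>k. m k \<in> cmp ?A k" and sum: "(\<Sum>k\<in>UNIV. m k) = 0"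
      have "\<forall>k. \<exists>a b c d. m k = W_elt a b c d \<and>
        (a \<noteq> 0 \<longrightarrow> k = 0) \<and> (b \<noteq> 0 \<longrightarrow> k = g) \<and> (c \<noteq> 0 \<longrightarrow> k = h) \<and> (d \<noteq> 0 \<longrightarrow> k = g + h)"
        using m by (simp add: W_cmp)
      then obtain a b c d where abcd: "\<And>k. m k = W_elt (a k) (b k) (c k) (d k)"
        "\<And>k. a k \<noteq> 0 \<longrightarrow> k = 0" "\<And>k. b k \<noteq> 0 \<longrightarrow> k = g"
        "\<And>k. c k \<noteq> 0 \<longrightarrow> k = h" "\<And>k. d k \<noteq> 0 \<longrightarrow> k = g + h"
        by metis
      have "(\<Sum>k\<in>K. m k) = W_elt (sum a K) (sum b K) (sum c K) (sum d K)" if "finite K" for K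
        using that by (induction K) (simp_all add: abcd(1) W_elt_add W_elt_basis)
      then have s0: "sum a UNIV = 0" "sum b UNIV = 0" "sum c UNIV = 0" "sum d UNIV = 0"
        using sum by (simp_all add: W_elt_basis)
      have single: "f k = 0" if "\<And>k. f k \<noteq> 0 \<longrightarrow> k = l" "sum f UNIV = 0" for f :: "'g \<Rightarrow> 'f" and l
      proof -
        have "sum f UNIV = sum f {l}" using that(1) by (intro sum.mono_neutral_right) auto
        then show ?thesis using that by (cases "k = l") auto
      qed
      have "a k = 0" "b k = 0" "c k = 0" "d k = 0"
        using single[of a] single[of b] single[of c] single[of d] abcd(2-) s0 by blast+
      then show "m k = 0" by (simp add: abcd(1) W_elt_basis)
    next
      fix x y k l assume x: "x \<in> cmp ?A k" and y: "y \<in> cmp ?A l"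
      from x obtain a b c d where 1: "x = W_elt a b c d" "a \<noteq> 0 \<longrightarrow> k = 0" "b \<noteq> 0 \<longrightarrow> k = g"
        "c \<noteq> 0 \<longrightarrow> k = h" "d \<noteq> 0 \<longrightarrow> k = g + h" unfolding W_cmp by blast
      from y obtain a' b' c' d' where 2: "y = W_elt a' b' c' d'" "a' \<noteq> 0 \<longrightarrow> l = 0" "b' \<noteq> 0 \<longrightarrow> l = g"
        "c' \<noteq> 0 \<longrightarrow> l = h" "d' \<noteq> 0 \<longrightarrow> l = g + h" unfolding W_cmp by blast
      let ?a = "a * a'" and ?b = "a * b' + b * a'" and ?c = "a * c' + c * a'"
        and ?d = "a * d' + b * c' + c * b' + d * a'"
      have "mul ?A x y = W_elt ?a ?b ?c ?d" by (simp add: 1 2 W_elt_mult)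
      moreover have "?a \<noteq> 0 \<longrightarrow> k + l = 0" using 1 2 by auto
      moreover have "?b \<noteq> 0 \<longrightarrow> k + l = g"
      proof
        assume "?b \<noteq> 0"
        then consider "a * b' \<noteq> 0" | "b * a' \<noteq> 0" by fastforce
        then show "k + l = g" using 1(2-) 2(2-) by cases (auto simp: add.commute)
      qed
      moreover have "?c \<noteq> 0 \<longrightarrow> k + l = h"
      proof
        assume "?c \<noteq> 0"
        then consider "a * c' \<noteq> 0" | "c * a' \<noteq> 0" by fastforce
        then show "k + l = h" using 1(2-) 2(2-) by cases (auto simp: add.commute)
      qed
      moreover have "?d \<noteq> 0 \<longrightarrow> k + l = g + h"
      proof
        assume "?d \<noteq> 0"
        then consider "a * d' \<noteq> 0" | "b * c' \<noteq> 0" | "c * b' \<noteq> 0" | "d * a' \<noteq> 0" by fastforce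
        then show "k + l = g + h" using 1(2-) 2(2-) by cases (auto simp: add.commute)
      qed
      ultimately show "mul ?A x y \<in> cmp ?A (k + l)" unfolding W_cmp by blast
    next
      show "unt ?A \<in> cmp ?A 0" unfolding W_cmp ops W_elt_basis by force
    next
      fix k
      have star_in: "\<nu> x \<in> cmp ?A k \<and> \<nu> (\<nu> x) = x" if "x \<in> cmp ?A k" for x
      proof -
        from that obtain a b c d where 1: "x = W_elt a b c d" "a \<noteq> 0 \<longrightarrow> k = 0" "b \<noteq> 0 \<longrightarrow> k = g"
          "c \<noteq> 0 \<longrightarrow> k = h" "d \<noteq> 0 \<longrightarrow> k = g + h" unfolding W_cmp by blast
        have "s * b \<noteq> 0 \<longrightarrow> k = g" "t * c \<noteq> 0 \<longrightarrow> k = h" "u * d \<noteq> 0 \<longrightarrow> k = g + h"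
          using 1 by auto
        then have "\<nu> x \<in> cmp ?A k" unfolding W_cmp using 1(1,2) nu by blast
        then show ?thesis by (simp add: 1(1) nu stu u mult.assoc[symmetric])
      qed
      show "star ?A ` cmp ?A k = cmp ?A k"
      proof
        show "star ?A ` cmp ?A k \<subseteq> cmp ?A k" using star_in by auto
        show "cmp ?A k \<subseteq> star ?A ` cmp ?A k"
        proof
          fix x assume "x \<in> cmp ?A k"
          then show "x \<in> star ?A ` cmp ?A k"
            using star_in by (intro image_eqI[of _ _ "\<nu> x"]) auto
        qed
      qed
    next
      fix x y assume "x \<in> gcarrier ?A" "y \<in> gcarrier ?A"
      then show "star ?A (mul ?A x y) = mul ?A (star ?A y) (star ?A x)"
        using stu u by (elim W_carrier) (simp add: W_elt_mult nu algebra_simps)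
    next
      fix x assume "x \<in> gcarrier ?A"
      then show "star ?A (star ?A x) = x"
        using stu u by (elim W_carrier) (simp add: nu mult.assoc[symmetric])
    next
      fix x y assume "x \<in> gcarrier ?A" "y \<in> gcarrier ?A"
      then show "star ?A (x + y) = star ?A x + star ?A y"
        by (elim W_carrier) (simp add: nu W_elt_add algebra_simps)
    next
      fix x k assume "x \<in> gcarrier ?A"
      then show "star ?A (scl ?A k x) = scl ?A k (star ?A x)"
        by (elim W_carrier) (simp add: nu W_elt_scale algebra_simps)
    qed (erule W_carrier, (erule W_carrier)?, (erule W_carrier)?,
        simp add: W_elt_mult W_elt_add W_elt_scale W_elt_basis(1) algebra_simps)+
  qed
qed

end

theory Submission
  imports Defs
begin

text \<open>
  The generators of the T-ideal make every two variables commute modulo it: a commutator of two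
  variables has the sign opposite to the only one with nonzero values in its degree, or else the
  product itself is a generator. So modulo the T-ideal only the multiset of letters of a word
  matters, and a word survives only if it is good: it involves no variable that takes only the
  value zero and, with \<open>g\<close>, \<open>h\<close> and \<open>gh\<close> weighted by the powers of the two generators of
  \<open>F[x, y]/(x\<^sup>2, y\<^sup>2)\<close>, each weight is at most one. Evaluating at generic points shows that the
  coefficients of good multisets vanish on identities. Hence these coefficients are coordinates
  of the relatively free algebra; each multilinear component has dimension at most one with trivial
  action, and the dimension of the space of all multilinear polynomials is \<open>(n + 1)\<^sup>2\<close>.
\<close>

section \<open>Linear extensions\<close>

text \<open>The three involutions differ only in their signs on \<open>W1\<close> and
  \<open>W2\<close>, so everything is proved once, in \<open>W_grading\<close>. Modulo the
  generators a commutator is killed by substituting the whole commutator for a single variable; to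
  have such substitutions, the free algebra is itself made a graded algebra with involution, and its
  endomorphisms are obtained as evaluations in it. The reduction to good multisets is proved for an
  arbitrary T-ideal containing the generators. For a general such ideal it gives minimality of the
  ideal of identities; for the ideal of identities itself it gives the coordinates on every
  quotient. Dimensions, traces and numbers of constituents are definite descriptions, so each needs
  a uniqueness argument: exchange for bases, and for constituents a comparison of degrees at the
  identity. The value (n + 1)^2 counts two independent choices: the position carrying the first
  weight and the one carrying the second, each among n positions or absent. Equal positions mean one
  variable of degree \<open>g + h\<close>.\<close>

lemma sum_singles:
  "(\<Sum>k\<in>Poly_Mapping.keys f. Poly_Mapping.single k (Poly_Mapping.lookup f k)) = f"
  by (rule poly_mapping_eqI)
    (auto simp: lookup_sum lookup_single when_def in_keys_iff sum.delta)

lemma poly_mapping_additive_induct [case_names single add]: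
  fixes f :: "'k \<Rightarrow>\<^sub>0 'b::comm_monoid_add"
  assumes "\<And>k c. P (Poly_Mapping.single k c)" "\<And>f g. P f \<Longrightarrow> P g \<Longrightarrow> P (f + g)"
  shows "P f"
proof -
  \<comment> \<open>A monomial with coefficient 0 is the zero polynomial, which supplies the empty
    sum.\<close>
  have "P 0" using assms(1)[of undefined 0] by simp
  have "P (\<Sum>k\<in>K. Poly_Mapping.single k (Poly_Mapping.lookup f k))" if "finite K" for K
    using that by induction (simp_all add: \<open>P 0\<close> assms)
  then show ?thesis by (metis sum_singles finite_keys)
qed

lemma pscale_single [simp]: "pscale c (Poly_Mapping.single k d) = Poly_Mapping.single k (c * d)"
  by (rule poly_mapping_eqI) (simp add: lookup_single when_def)

lemma single_eq_pscale: "Poly_Mapping.single k c = pscale c (Poly_Mapping.single k 1)"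
  by simp

text \<open>\<open>pushforward\<close>, \<open>free_star\<close> and \<open>free_eval\<close> are
  all sums over \<open>keys\<close> of this form, so their linearity has one source. The support
  depends on the argument; enlarging it to a common finite set only adds zero terms.\<close>

lemma (in vector_space) linear_on_basis:
  fixes G :: "'k \<Rightarrow> 'b"
  shows "Vector_Spaces.linear pscale scale
     (\<lambda>f. \<Sum>k\<in>Poly_Mapping.keys f. scale (Poly_Mapping.lookup f k) (G k))"
proof -
  let ?S = "\<lambda>f K. \<Sum>k\<in>K. scale (Poly_Mapping.lookup f k) (G k)"
  have ext: "?S f (Poly_Mapping.keys f) = ?S f K"
    if "finite K" "Poly_Mapping.keys f \<subseteq> K" for f K
    using that by (intro sum.mono_neutral_left) (auto simp: in_keys_iff)
  show ?thesis
  proof (intro Vector_Spaces.linear.intro module_hom.intro module_hom_axioms.intro)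
    fix f h :: "'k \<Rightarrow>\<^sub>0 'a"
    let ?K = "Poly_Mapping.keys f \<union> Poly_Mapping.keys h"
    have "?S (f + h) (Poly_Mapping.keys (f + h)) = ?S (f + h) ?K"
      by (intro ext) (use keys_add[of f h] in auto)
    also have "\<dots> = ?S f ?K + ?S h ?K"
      by (simp add: lookup_add scale_left_distrib sum.distrib)
    also have "?S f ?K = ?S f (Poly_Mapping.keys f)" by (rule ext[symmetric]) auto
    also have "?S h ?K = ?S h (Poly_Mapping.keys h)" by (rule ext[symmetric]) auto
    finally show "?S (f + h) (Poly_Mapping.keys (f + h)) =
        ?S f (Poly_Mapping.keys f) + ?S h (Poly_Mapping.keys h)" .
  next
    fix c and f :: "'k \<Rightarrow>\<^sub>0 'a"
    have "?S (pscale c f) (Poly_Mapping.keys (pscale c f)) = ?S (pscale c f) (Poly_Mapping.keys f)"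
      by (intro ext) (auto simp: in_keys_iff)
    then show "?S (pscale c f) (Poly_Mapping.keys (pscale c f)) =
        scale c (?S f (Poly_Mapping.keys f))"
      by (simp add: scale_sum_right)
  qed (rule pvs.vector_space_axioms vector_space_axioms pvs.module_axioms module_axioms)+
qed

lemma linear_pushforward: "Vector_Spaces.linear pscale pscale (pushforward \<phi>)"
proof -
  have eq: "pushforward \<phi> = (\<lambda>f. \<Sum>k\<in>Poly_Mapping.keys f.
      pscale (Poly_Mapping.lookup f k) (Poly_Mapping.single (\<phi> k) 1))"
    by (simp add: pushforward_def fun_eq_iff)
  show ?thesis unfolding eq by (rule pvs.linear_on_basis)
qed

lemma pushforward_single [simp]:
  "pushforward \<phi> (Poly_Mapping.single k c) = Poly_Mapping.single (\<phi> k) c"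
  by (simp add: pushforward_def)

lemma linear_free_star: "Vector_Spaces.linear pscale pscale (free_star :: ('f::field, 'g) free \<Rightarrow> _)"
proof -
  have eq: "(free_star :: ('f, 'g) free \<Rightarrow> _) = (\<lambda>f. \<Sum>k\<in>Poly_Mapping.keys f. pscale (Poly_Mapping.lookup f k)
      (Poly_Mapping.single (rev k) (prod_list (map (\<lambda>v. pm_val (vsgn v)) k))))"
    by (simp add: free_star_def fun_eq_iff mult.commute)
  show ?thesis unfolding eq by (rule pvs.linear_on_basis)
qed

lemma free_star_single [simp]:
  "free_star (Poly_Mapping.single w c) =
     Poly_Mapping.single (rev w) (prod_list (map (\<lambda>v. pm_val (vsgn v)) w) * c)"
  by (simp add: free_star_def)

lemma linear_simps:
  assumes "Vector_Spaces.linear s1 s2 f"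
  shows "f (x + y) = f x + f y" "f (x - y) = f x - f y" "f (s1 c x) = s2 c (f x)" "f 0 = 0"
    "f (sum a K) = (\<Sum>k\<in>K. f (a k))"
proof -
  interpret Vector_Spaces.linear s1 s2 f by fact
  show "f (x + y) = f x + f y" "f (x - y) = f x - f y" "f (s1 c x) = s2 c (f x)" "f 0 = 0"
    "f (sum a K) = (\<Sum>k\<in>K. f (a k))"
    by (simp_all add: add diff scale sum)
qed

lemmas pushforward_linear = linear_simps[OF linear_pushforward]
lemmas free_star_linear = linear_simps[OF linear_free_star]


section \<open>Evaluation of polynomials\<close>

lemma pm_val_square [simp]: "pm_val e * pm_val e = 1"
  by (cases e) simp_all

context gstar_algebra
begin

lemma gcarrier_cmp: "x \<in> cmp A k \<Longrightarrow> x \<in> gcarrier A"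
  unfolding gcarrier_def
  by (intro CollectI exI[of _ "\<lambda>l. if l = k then x else 0"]) (auto simp: subspace_0[OF subspace_cmp])

lemma gcarrier_subspace: "subspace (gcarrier A)"
proof (rule subspaceI)
  show "0 \<in> gcarrier A" using subspace_0[OF subspace_cmp] by (rule gcarrier_cmp)
next
  fix x y assume "x \<in> gcarrier A" "y \<in> gcarrier A"
  then obtain a b where "x = (\<Sum>g\<in>UNIV. a g)" "\<forall>g. a g \<in> cmp A g" "y = (\<Sum>g\<in>UNIV. b g)" "\<forall>g. b g \<in> cmp A g"
    by (auto simp: gcarrier_def)
  then show "x + y \<in> gcarrier A" unfolding gcarrier_def
    by (intro CollectI exI[of _ "\<lambda>g. a g + b g"]) (auto simp: sum.distrib subspace_add[OF subspace_cmp])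
next
  fix c x assume "x \<in> gcarrier A"
  then obtain a where "x = (\<Sum>g\<in>UNIV. a g)" "\<forall>g. a g \<in> cmp A g" by (auto simp: gcarrier_def)
  then show "scl A c x \<in> gcarrier A" unfolding gcarrier_def
    by (intro CollectI exI[of _ "\<lambda>g. scl A c (a g)"])
      (auto simp: scale_sum_right subspace_scale[OF subspace_cmp])
qed

lemma pm_cmp_iff: "a \<in> pm_cmp A k e \<longleftrightarrow> a \<in> cmp A k \<and> star A a = scl A (pm_val e) a"
  by (cases e) simp_all

definition admissible :: "('g var \<Rightarrow> 'a) \<Rightarrow> bool"
  where "admissible \<rho> \<longleftrightarrow> (\<forall>v. \<rho> v \<in> pm_cmp A (vdeg v) (vsgn v))"

lemma admissible_iff: "admissible \<rho> \<longleftrightarrow> (\<forall>i g e. \<rho> (Var i g e) \<in> pm_cmp A g e)"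
  unfolding admissible_def by (metis var.collapse var.sel)

definition word_eval :: "('g var \<Rightarrow> 'a) \<Rightarrow> 'g var list \<Rightarrow> 'a"
  where "word_eval \<rho> w = foldr (\<lambda>v. mul A (\<rho> v)) w (unt A)"

lemma word_eval_simps [simp]:
  "word_eval \<rho> [] = unt A" "word_eval \<rho> (v # w) = mul A (\<rho> v) (word_eval \<rho> w)"
  by (simp_all add: word_eval_def)

lemma linear_free_eval: "Vector_Spaces.linear pscale (scl A) (free_eval A \<rho>)"
  unfolding free_eval_def by (rule linear_on_basis)

lemmas free_eval_linear = linear_simps[OF linear_free_eval]

lemma free_eval_single: "free_eval A \<rho> (Poly_Mapping.single w c) = scl A c (word_eval \<rho> w)"
  by (simp add: free_eval_def word_eval_def)

lemma admissibleD:
  assumes "admissible \<rho>"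
  shows "\<rho> v \<in> cmp A (vdeg v)" "star A (\<rho> v) = scl A (pm_val (vsgn v)) (\<rho> v)"
    "\<rho> v \<in> gcarrier A"
  using assms gcarrier_cmp by (auto simp: admissible_def pm_cmp_iff)

lemma word_eval_cmp: "admissible \<rho> \<Longrightarrow> word_eval \<rho> w \<in> cmp A (sum_list (map vdeg w))"
  by (induction w) (auto intro!: mul_cmp unt_cmp admissibleD)

lemmas word_eval_gcarrier = gcarrier_cmp[OF word_eval_cmp]

lemma word_eval_append:
  "admissible \<rho> \<Longrightarrow> word_eval \<rho> (u @ w) = mul A (word_eval \<rho> u) (word_eval \<rho> w)"
  by (induction u) (simp_all add: unt_mul mul_assoc word_eval_gcarrier admissibleD(3))

text \<open>The locale does not postulate this. It follows by applying the involution to the product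
  of the star of the unit with the unit, once as an antiautomorphism and once after cancelling the
  unit.\<close>

lemma star_unt: "star A (unt A) = unt A"
proof -
  have u: "unt A \<in> gcarrier A" "star A (unt A) \<in> gcarrier A"
    using unt_cmp star_cmp[of 0] gcarrier_cmp by blast+
  have "star A (unt A) = mul A (star A (unt A)) (star A (star A (unt A)))"
    using u by (simp add: star_star mul_unt)
  also have "\<dots> = star A (mul A (star A (unt A)) (unt A))"
    using u by (simp add: star_mul)
  also have "\<dots> = unt A" using u by (simp add: mul_unt star_star)
  finally show ?thesis .
qed

lemma star_word_eval:
  assumes "admissible \<rho>"
  shows "star A (word_eval \<rho> w) =
    scl A (prod_list (map (\<lambda>v. pm_val (vsgn v)) w)) (word_eval \<rho> (rev w))"
proof (induction w)
  case (Cons v w)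
  note [simp] = word_eval_gcarrier[OF assms] admissibleD[OF assms]
  have "star A (word_eval \<rho> (v # w)) = mul A (star A (word_eval \<rho> w)) (star A (\<rho> v))"
    by (simp add: star_mul)
  also have "\<dots> = scl A (prod_list (map (\<lambda>v. pm_val (vsgn v)) (v # w)))
      (mul A (word_eval \<rho> (rev w)) (\<rho> v))"
    unfolding Cons.IH
    by (simp add: mul_scl scl_mul subspace_scale[OF gcarrier_subspace] mult.commute)
  also have "mul A (word_eval \<rho> (rev w)) (\<rho> v) = word_eval \<rho> (rev (v # w))"
    by (simp add: word_eval_append[OF assms] mul_unt)
  finally show ?case .
qed (simp add: star_unt)

lemma free_eval_cmp:
  assumes "admissible \<rho>" "f \<in> free_cmp k"
  shows "free_eval A \<rho> f \<in> cmp A k"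
  unfolding free_eval_def
proof (intro subspace_sum[OF subspace_cmp] subspace_scale[OF subspace_cmp])
  fix w assume "w \<in> Poly_Mapping.keys f"
  then show "foldr (\<lambda>v. mul A (\<rho> v)) w (unt A) \<in> cmp A k"
    using assms(2) word_eval_cmp[OF assms(1), of w] by (simp add: free_cmp_def word_eval_def)
qed

lemma free_eval_gcarrier:
  assumes "admissible \<rho>"
  shows "free_eval A \<rho> f \<in> gcarrier A"
  by (induction f rule: poly_mapping_additive_induct)
    (auto simp: free_eval_single free_eval_linear
      intro: subspace_scale[OF gcarrier_subspace] subspace_add[OF gcarrier_subspace]
        word_eval_gcarrier[OF assms])

lemma free_eval_mult:
  assumes "admissible \<rho>"
  shows "free_eval A \<rho> (p * q) = mul A (free_eval A \<rho> p) (free_eval A \<rho> q)"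
proof (induction p rule: poly_mapping_additive_induct)
  note [simp] = word_eval_gcarrier[OF assms] free_eval_gcarrier[OF assms]
  {
    case (single u c)
    show ?case
      by (induction q rule: poly_mapping_additive_induct)
        (simp_all add: mult_single free_eval_single plus_list_def word_eval_append[OF assms]
          mul_scl scl_mul subspace_scale[OF gcarrier_subspace] distrib_left free_eval_linear mul_add)
  next
    case (add p p')
    then show ?case by (simp add: distrib_right free_eval_linear add_mul)
  }
qed

lemma free_eval_one: "free_eval A \<rho> 1 = unt A"
  by (simp add: free_eval_single zero_list_def flip: single_one)

lemma free_eval_star:
  assumes "admissible \<rho>"
  shows "free_eval A \<rho> (free_star f) = star A (free_eval A \<rho> f)"
proof (induction f rule: poly_mapping_additive_induct)
  case (single w c)
  show ?case
    by (simp add: free_eval_single star_scl word_eval_gcarrier[OF assms] star_word_eval[OF assms]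
        mult.commute)
next
  case (add p q)
  then show ?case by (simp add: free_eval_linear free_star_linear star_add free_eval_gcarrier[OF assms])
qed

lemma Id_sharp_iff: "f \<in> Id_sharp A \<longleftrightarrow> (\<forall>\<rho>. admissible \<rho> \<longrightarrow> free_eval A \<rho> f = 0)"
  by (simp add: Id_sharp_def admissible_iff)

lemma free_eval_X: "admissible \<rho> \<Longrightarrow> free_eval A \<rho> (X i k e) = \<rho> (Var i k e)"
  by (simp add: X_def free_eval_single mul_unt admissibleD)

end

lemma X_var: "X (vnum v) (vdeg v) (vsgn v) = Poly_Mapping.single [v] 1"
  by (simp add: X_def)

lemma X_free_cmp: "X i k e \<in> free_cmp k"
  by (auto simp: X_def free_cmp_def)

lemma free_star_X: "free_star (X i k e) = pscale (pm_val e) (X i k e)"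
  by (simp add: X_def)

lemma X_mult: "X i k e * X j l d = Poly_Mapping.single [Var i k e, Var j l d] 1"
  by (simp add: X_def mult_single plus_list_def)

context gstar_algebra
begin

text \<open>Evaluating after an endomorphism is evaluating at another point, the values of the
  images of the variables. Compatibility with grading and star makes that point admissible, so
  identities are stable under endomorphisms.\<close>

lemma free_eval_endo:
  assumes \<phi>: "free_endo \<phi>" and \<rho>: "admissible \<rho>"
  defines "\<rho>' \<equiv> (\<lambda>v. free_eval A \<rho> (\<phi> (Poly_Mapping.single [v] 1)))"
  shows "admissible \<rho>'" "free_eval A \<rho> (\<phi> f) = free_eval A \<rho>' f"
proof -
  have lin: "Vector_Spaces.linear pscale pscale \<phi>" and one: "\<phi> 1 = 1"
    and mult: "\<And>p q. \<phi> (p * q) = \<phi> p * \<phi> q" and deg: "\<And>k. \<phi> ` free_cmp k \<subseteq> free_cmp k"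
    and star: "\<And>p. \<phi> (free_star p) = free_star (\<phi> p)"
    using \<phi> by (auto simp: free_endo_def)
  show adm: "admissible \<rho>'"
    unfolding admissible_def pm_cmp_iff
  proof (intro allI conjI)
    fix v
    let ?x = "Poly_Mapping.single [v] 1 :: ('f, 'g) free"
    have x: "?x \<in> free_cmp (vdeg v)" "free_star ?x = pscale (pm_val (vsgn v)) ?x"
      using X_free_cmp[of "vnum v" "vdeg v" "vsgn v"] free_star_X[of "vnum v" "vdeg v" "vsgn v"]
      by (simp_all add: X_var)
    show "\<rho>' v \<in> cmp A (vdeg v)"
      unfolding \<rho>'_def using deg x(1) by (intro free_eval_cmp \<rho>) auto
    show "star A (\<rho>' v) = scl A (pm_val (vsgn v)) (\<rho>' v)"
      unfolding \<rho>'_def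
      by (simp add: free_eval_star[OF \<rho>, symmetric] star[symmetric] x(2) linear_simps[OF lin]
          free_eval_linear del: pscale_single free_star_single)
  qed
  have w: "free_eval A \<rho> (\<phi> (Poly_Mapping.single w 1)) = word_eval \<rho>' w" for w
  proof (induction w)
    case Nil
    have "Poly_Mapping.single [] 1 = (1 :: ('f, 'g) free)"
      by (metis single_one zero_list_def)
    then show ?case by (simp add: one free_eval_one)
  next
    case (Cons v w)
    have "Poly_Mapping.single (v # w) 1 = Poly_Mapping.single [v] 1 * (Poly_Mapping.single w 1 :: ('f, 'g) free)"
      by (simp add: mult_single plus_list_def)
    then show ?case by (simp add: mult free_eval_mult[OF \<rho>] Cons.IH \<rho>'_def)
  qed
  show "free_eval A \<rho> (\<phi> f) = free_eval A \<rho>' f"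
  proof (induction f rule: poly_mapping_additive_induct)
    case (single k c)
    show ?case
      by (subst single_eq_pscale)
        (simp add: linear_simps[OF lin] free_eval_linear w free_eval_single del: pscale_single)
  qed (simp add: linear_simps[OF lin] free_eval_linear)
qed

theorem T_ideal_Id_sharp: "T_ideal (Id_sharp A)"
  unfolding T_ideal_def
proof (intro conjI ballI allI impI)
  show "pvs.subspace (Id_sharp A)"
    by (auto simp: pvs.subspace_def Id_sharp_iff free_eval_linear)
next
  fix p q assume p: "p \<in> Id_sharp A"
  \<comment> \<open>Absorption by zero is homogeneity with scalar 0.\<close>
  have zl: "mul A 0 z = 0" and zr: "mul A z 0 = 0" if "z \<in> gcarrier A" for z
    using scl_mul[of 0 z 0] mul_scl[of z 0 0] that subspace_0[OF gcarrier_subspace] by simp_all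
  show "p * q \<in> Id_sharp A" "q * p \<in> Id_sharp A"
    using p by (auto simp: Id_sharp_iff free_eval_mult zl zr free_eval_gcarrier)
next
  have "star A 0 = 0" using star_scl[of 0 0] subspace_0[OF gcarrier_subspace] by simp
  then show "free_star ` Id_sharp A \<subseteq> Id_sharp A"
    by (auto simp: Id_sharp_iff free_eval_star)
next
  fix \<phi> :: "('f, 'g) free \<Rightarrow> ('f, 'g) free"
  assume \<phi>: "free_endo \<phi>"
  show "\<phi> ` Id_sharp A \<subseteq> Id_sharp A"
  proof clarify
    fix f assume f: "f \<in> Id_sharp A"
    show "\<phi> f \<in> Id_sharp A"
      unfolding Id_sharp_iff
    proof (intro allI impI)
      fix \<rho> assume \<rho>: "admissible \<rho>"
      note free_eval_endo(2)[OF \<phi> \<rho>, of f]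
      also note Id_sharp_iff[THEN iffD1, OF f, rule_format, OF free_eval_endo(1)[OF \<phi> \<rho>]]
      finally show "free_eval A \<rho> (\<phi> f) = 0" .
    qed
  qed
qed

end


section \<open>Substitutions in the free algebra\<close>

text \<open>As an algebra of this kind, the free algebra turns substitution of polynomials for
  variables into an instance of \<open>free_eval\<close>, and the lemmas on evaluation then say that
  substitution is an endomorphism.\<close>

definition free_alg :: "('f::field, 'g::{finite,ab_group_add}, ('f, 'g) free) gstar_alg"
  where "free_alg = \<lparr>scl = pscale, mul = (*), unt = 1, cmp = free_cmp, star = free_star\<rparr>"

lemma free_alg_simps [simp]:
  "scl free_alg = pscale" "mul free_alg = (*)" "unt free_alg = 1" "cmp free_alg = free_cmp"
  "star free_alg = free_star"
  by (simp_all add: free_alg_def)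

lemma pscale_mult: "pscale c p * q = pscale c (p * q)" "p * pscale c q = pscale c (p * q)"
  for p q :: "('f::field, 'g) free"
proof -
  \<comment> \<open>A scalar acts as the constant on the empty word, from either side, so both
    claims become associativity.\<close>
  have l: "pscale c p = Poly_Mapping.single [] c * p" for p :: "('f, 'g) free"
    by (induction p rule: poly_mapping_additive_induct)
      (simp_all add: mult_single plus_list_def distrib_left pvs.scale_right_distrib)
  have r: "pscale c p = p * Poly_Mapping.single [] c" for p :: "('f, 'g) free"
    by (induction p rule: poly_mapping_additive_induct)
      (simp_all add: mult_single plus_list_def distrib_right pvs.scale_right_distrib mult.commute)
  show "pscale c p * q = pscale c (p * q)" by (simp only: l mult.assoc)
  show "p * pscale c q = pscale c (p * q)" by (simp only: r mult.assoc)
qed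

lemma free_star_free_star [simp]:
  fixes p :: "('a::field, 'b) free"
  shows "free_star (free_star p) = p"
proof (induction p rule: poly_mapping_additive_induct)
  case (single w c)
  have rev: "prod_list (map s (rev w)) = prod_list (map s w)" for s :: "'b var \<Rightarrow> 'a"
    by (induction w) (simp_all add: mult.commute)
  have "prod_list (map (\<lambda>v. pm_val (vsgn v)) w) * prod_list (map (\<lambda>v. pm_val (vsgn v)) w) = (1 :: 'a)"
  proof (induction w)
    case (Cons v w)
    have "(a * b) * (a * b) = (a * a) * (b * b)" for a b :: 'a by (simp only: mult_ac)
    then show ?case by (simp only: list.map prod_list.Cons Cons.IH pm_val_square mult_1_right)
  qed simp
  then show ?case unfolding free_star_single rev rev_rev_ident by (simp flip: mult.assoc)
qed (simp add: free_star_linear)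

lemma free_star_mult: "free_star (p * q) = free_star q * free_star p"
proof (induction p rule: poly_mapping_additive_induct)
  case (single u c)
  show ?case
    by (induction q rule: poly_mapping_additive_induct)
      (simp_all add: mult_single plus_list_def distrib_left distrib_right free_star_linear mult_ac)
qed (simp add: distrib_left distrib_right free_star_linear)

lemma free_cmp_subspace: "pvs.subspace (free_cmp k)"
  unfolding pvs.subspace_def free_cmp_def
  by (auto simp: in_keys_iff lookup_add)

lemma free_cmp_single: "Poly_Mapping.single w c \<in> free_cmp (sum_list (map vdeg w))"
  by (auto simp: free_cmp_def)

lemma free_star_free_cmp: "f \<in> free_cmp k \<Longrightarrow> free_star f \<in> free_cmp k"
proof -
  assume f: "f \<in> free_cmp k"
  show "free_star f \<in> free_cmp k"
    unfolding free_star_def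
  proof (rule pvs.subspace_sum[OF free_cmp_subspace])
    fix w assume "w \<in> Poly_Mapping.keys f"
    then have "sum_list (map vdeg (rev w)) = k"
      using f by (simp add: free_cmp_def flip: rev_map)
    then show "Poly_Mapping.single (rev w) (prod_list (map (\<lambda>v. pm_val (vsgn v)) w) *
        Poly_Mapping.lookup f w) \<in> free_cmp k"
      using free_cmp_single by blast
  qed
qed

lemma free_cmp_mult: "p \<in> free_cmp k \<Longrightarrow> q \<in> free_cmp l \<Longrightarrow> p * q \<in> free_cmp (k + l)"
  unfolding free_cmp_def using keys_mult[of p q] by (fastforce simp: plus_list_def)

theorem gstar_algebra_free_alg:
  "gstar_algebra (free_alg :: ('f::field, 'g::{finite,ab_group_add}, ('f, 'g) free) gstar_alg)"
proof (intro_locales)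
  let ?A = "free_alg :: ('f, 'g, ('f, 'g) free) gstar_alg"
  show "vector_space (scl ?A)" by (simp add: pvs.vector_space_axioms)
  show "gstar_algebra_axioms ?A"
  proof
    fix k
    show "module.subspace (scl ?A) (cmp ?A k)" by (simp add: free_cmp_subspace)
    show "star ?A ` cmp ?A k = cmp ?A k"
      by (auto simp: free_star_free_cmp intro!: image_eqI[of _ free_star "free_star _"])
  next
    fix a :: "'g \<Rightarrow> ('f, 'g) free" and k
    assume a: "\<And>k. a k \<in> cmp ?A k" and sum: "(\<Sum>k\<in>UNIV. a k) = 0"
    show "a k = 0"
    proof (rule poly_mapping_eqI)
      fix w
      \<comment> \<open>A word has a single degree, so only one component can contribute to its
        coefficient.\<close>
      have z: "Poly_Mapping.lookup (a l) w = 0" if "l \<noteq> sum_list (map vdeg w)" for l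
        using a[of l] that by (auto simp: free_cmp_def in_keys_iff)
      have "(\<Sum>l\<in>UNIV. Poly_Mapping.lookup (a l) w) = 0"
        using sum by (simp flip: lookup_sum)
      then have "(\<Sum>l\<in>{sum_list (map vdeg w)}. Poly_Mapping.lookup (a l) w) = 0"
        using z by (subst sum.mono_neutral_left[of UNIV]) auto
      then show "Poly_Mapping.lookup (a k) w = Poly_Mapping.lookup 0 w"
        using z[of k] by (cases "k = sum_list (map vdeg w)") auto
    qed
  next
    show "unt ?A \<in> cmp ?A 0"
      using free_cmp_single[of "[]" 1] by (simp flip: single_one add: zero_list_def)
  qed (auto simp: free_cmp_mult free_star_mult free_star_linear pscale_mult distrib_left
      distrib_right mult.assoc)
qed

text \<open>The universal property of the free algebra: the assumptions say that
  \<open>\<theta>\<close> is an admissible point of \<open>free_alg\<close>, hence evaluation there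
  is a \<open>free_endo\<close>.\<close>

lemma T_ideal_subst:
  fixes \<theta> :: "'g::{finite,ab_group_add} var \<Rightarrow> ('f::field, 'g) free"
  assumes I: "T_ideal I" "p \<in> I"
    and \<theta>: "\<And>v. \<theta> v \<in> free_cmp (vdeg v)" "\<And>v. free_star (\<theta> v) = pscale (pm_val (vsgn v)) (\<theta> v)"
  shows "free_eval free_alg \<theta> p \<in> I"
proof -
  interpret free: gstar_algebra "free_alg :: ('f, 'g, ('f, 'g) free) gstar_alg"
    by (rule gstar_algebra_free_alg)
  have adm: "free.admissible \<theta>"
    using \<theta> by (simp add: free.admissible_def free.pm_cmp_iff)
  have "free_endo (free_eval free_alg \<theta>)"
    unfolding free_endo_def
    using free.linear_free_eval[of \<theta>] free.free_eval_one[of \<theta>] free.free_eval_mult[OF adm]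
      free.free_eval_cmp[OF adm] free.free_eval_star[OF adm] by auto
  then show ?thesis using I unfolding T_ideal_def by blast
qed

lemma free_eval_free_alg_X: "free_eval free_alg \<theta> (X i k e) = \<theta> (Var i k e)"
  by (simp add: X_def free_eval_def)

lemma free_eval_free_alg_X2:
  "free_eval free_alg \<theta> (X i k e * X j l d) = \<theta> (Var i k e) * \<theta> (Var j l d)"
  by (simp add: X_mult free_eval_def)

text \<open>A linear generator thus kills every homogeneous polynomial of its degree and sign,
  commutators included.\<close>

lemma T_ideal_X_subst:
  fixes q :: "('f::field, 'g::{finite,ab_group_add}) free"
  assumes "T_ideal I" "X i k e \<in> I" "q \<in> free_cmp k" "free_star q = pscale (pm_val e) q"
  shows "q \<in> I"
proof -
  have "free_eval free_alg (\<lambda>v. if v = Var i k e then q else X (vnum v) (vdeg v) (vsgn v)) (X i k e) \<in> I"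
    by (rule T_ideal_subst) (use assms in \<open>auto simp: X_free_cmp free_star_X\<close>)
  then show ?thesis by (simp add: free_eval_free_alg_X)
qed

text \<open>The numbers 0 and 1 keep the two variables distinct even when degrees and signs agree,
  so they can be renamed independently.\<close>

lemma T_ideal_X_mult_rename:
  fixes I :: "('f::field, 'g::{finite,ab_group_add}) free set"
  assumes "T_ideal I" "X 0 k e * X 1 l d \<in> I"
  shows "X i k e * X j l d \<in> I"
proof -
  let ?\<theta> = "\<lambda>v. if v = Var 0 k e then X i k e else if v = Var 1 l d then X j l d
    else (X (vnum v) (vdeg v) (vsgn v) :: ('f, 'g) free)"
  have "free_eval free_alg ?\<theta> (X 0 k e * X 1 l d) \<in> I"
    by (rule T_ideal_subst) (use assms in \<open>auto simp: X_free_cmp free_star_X\<close>)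
  then show ?thesis by (simp add: free_eval_free_alg_X2)
qed

lemma T_ideal_star: "T_ideal I \<Longrightarrow> p \<in> I \<Longrightarrow> free_star p \<in> I"
  unfolding T_ideal_def by blast

lemma T_ideal_mult:
  assumes "T_ideal I" "p \<in> I"
  shows "p * q \<in> I" "q * p \<in> I"
  using assms unfolding T_ideal_def by blast+

lemma T_ideal_subspace: "T_ideal I \<Longrightarrow> pvs.subspace I"
  unfolding T_ideal_def by blast


section \<open>Dimension and trace on a quotient\<close>

lemma basis_mod_card_le:
  fixes P :: "('k \<Rightarrow>\<^sub>0 'f::field) set"
  assumes P: "pvs.subspace P" and Q: "pvs.subspace Q" and B: "basis_mod P Q B" and B': "basis_mod P Q B'"
  shows "card B' \<le> card B"
proof -
  have fin: "finite B" "finite B'" and sub: "B' \<subseteq> P"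
    using B B' by (auto simp: basis_mod_def)
  have "\<forall>b'\<in>B'. \<exists>c. is_coords_mod Q B b' c"
    using B sub unfolding basis_mod_def by blast
  then obtain C where C: "\<And>b'. b' \<in> B' \<Longrightarrow> is_coords_mod Q B b' (C b')" by metis
  define \<Phi> where "\<Phi> b' = (\<Sum>b\<in>B. Poly_Mapping.single b (C b' b))" for b'
  have \<Phi>: "Poly_Mapping.lookup (\<Phi> b') b = (if b \<in> B then C b' b else 0)" for b' b
    using fin by (simp add: \<Phi>_def lookup_sum lookup_single when_def)
  have ind: "u b' = 0" if u: "(\<Sum>b'\<in>B'. pscale (u b') (\<Phi> b')) = 0" and "b' \<in> B'" for u b'
  proof -
    have z: "(\<Sum>b'\<in>B'. u b' * C b' b) = 0" if "b \<in> B" for b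
      using arg_cong[OF u, of "\<lambda>f. Poly_Mapping.lookup f b"] that by (simp add: lookup_sum \<Phi>)
    have "(\<Sum>b'\<in>B'. pscale (u b') (b' - (\<Sum>b\<in>B. pscale (C b' b) b))) \<in> Q"
      using C by (intro pvs.subspace_sum[OF Q] pvs.subspace_scale[OF Q]) (simp add: is_coords_mod_def)
    also have "(\<Sum>b'\<in>B'. pscale (u b') (b' - (\<Sum>b\<in>B. pscale (C b' b) b))) =
        (\<Sum>b'\<in>B'. pscale (u b') b') - (\<Sum>b\<in>B. pscale (\<Sum>b'\<in>B'. u b' * C b' b) b)"
      by (simp add: pvs.scale_right_diff_distrib sum_subtractf pvs.scale_sum_right
          pvs.scale_sum_left sum.swap[of _ B B'])
    also have "\<dots> = (\<Sum>b'\<in>B'. pscale (u b') b')" by (simp add: z)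
    finally have "(\<Sum>b'\<in>B'. pscale (u b') b') \<in> Q" .
    \<comment> \<open>The combination is subtracted in \<open>is_coords_mod\<close>, whence the
      minus sign. Both this family and the zero family are coordinates of 0.\<close>
    then have "is_coords_mod Q B' 0 (\<lambda>b. if b \<in> B' then - u b else 0)"
      by (simp add: is_coords_mod_def sum_negf)
    moreover have "is_coords_mod Q B' 0 (\<lambda>b. 0)"
      by (simp add: is_coords_mod_def pvs.subspace_0[OF Q])
    ultimately have "(\<lambda>b. if b \<in> B' then - u b else 0) = (\<lambda>b. 0)"
      using B' pvs.subspace_0[OF P] unfolding basis_mod_def by blast
    from fun_cong[OF this, of b'] show ?thesis using \<open>b' \<in> B'\<close> by simp
  qed
  have inj: "inj_on \<Phi> B'"
  proof (rule inj_onI, rule ccontr)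
    fix x y assume xy: "x \<in> B'" "y \<in> B'" "\<Phi> x = \<Phi> y" "x \<noteq> y"
    \<comment> \<open>Equal images would give the nontrivial relation with coefficients 1 at
      \<open>x\<close> and -1 at \<open>y\<close>.\<close>
    have "(\<Sum>b'\<in>B'. pscale (if b' = x then 1 else if b' = y then -1 else 0) (\<Phi> b')) =
        (\<Sum>b'\<in>{x, y}. pscale (if b' = x then 1 else if b' = y then -1 else 0) (\<Phi> b'))"
      using xy fin by (intro sum.mono_neutral_right) auto
    also have "\<dots> = 0" using xy by simp
    finally show False using ind[OF _ xy(1)] by fastforce
  qed
  have "pvs.independent (\<Phi> ` B')"
  proof (rule pvs.independent_if_scalars_zero)
    fix u x assume "(\<Sum>x\<in>\<Phi> ` B'. pscale (u x) x) = 0" "x \<in> \<Phi> ` B'"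
    then show "u x = 0" using ind[of "\<lambda>b'. u (\<Phi> b')"] by (auto simp: sum.reindex[OF inj])
  qed (use fin in simp)
  moreover have "\<Phi> ` B' \<subseteq> pvs.span ((\<lambda>b. Poly_Mapping.single b 1) ` B)"
  proof clarify
    fix b' show "\<Phi> b' \<in> pvs.span ((\<lambda>b. Poly_Mapping.single b 1) ` B)"
      unfolding \<Phi>_def
      by (intro pvs.span_sum, subst single_eq_pscale)
        (intro pvs.span_scale pvs.span_base imageI)
  qed
  ultimately have "card (\<Phi> ` B') \<le> card ((\<lambda>b. Poly_Mapping.single b (1 :: 'f)) ` B)"
    using fin pvs.independent_span_bound by blast
  also have "\<dots> \<le> card B" by (rule card_image_le[OF fin(1)])
  finally show ?thesis by (simp add: card_image[OF inj])
qed

lemma quot_dim_eq: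
  assumes "pvs.subspace P" "pvs.subspace Q" "basis_mod P Q B"
  shows "quot_dim P Q = card B"
  unfolding quot_dim_def
  by (rule the_equality) (use assms basis_mod_card_le in \<open>blast intro: le_antisym\<close>)+

text \<open>Here \<open>T\<close> induces the identity on the quotient, so the coordinates of
  \<open>T b\<close> are the unit vector at \<open>b\<close> in every basis. All traces computed
  below are of this kind.\<close>

lemma quot_trace_eq:
  assumes P: "pvs.subspace P" and Q: "pvs.subspace Q" "Q \<subseteq> P" and B: "basis_mod P Q B"
    and T: "\<And>p. p \<in> P \<Longrightarrow> T p - p \<in> Q"
  shows "quot_trace P Q T = of_nat (card B)"
proof -
  have "(\<Sum>b\<in>B. (THE c. is_coords_mod Q B (T b) c) b) = of_nat (card B)" if B: "basis_mod P Q B" for B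
  proof -
    have "(THE c. is_coords_mod Q B (T b) c) b = 1" if b: "b \<in> B" for b
    proof -
      have fin: "finite B" and bP: "b \<in> P" using B b by (auto simp: basis_mod_def)
      \<comment> \<open>Membership of \<open>T b\<close> in \<open>P\<close> comes from
        \<open>T b - b\<close> lying in \<open>Q\<close>.\<close>
      have "T b - b + b \<in> P" using T[OF bP] Q(2) bP by (intro pvs.subspace_add[OF P]) auto
      then have uniq: "\<exists>!c. is_coords_mod Q B (T b) c" using B by (simp add: basis_mod_def)
      have "(\<Sum>x\<in>B. pscale (if x = b then 1 else 0) x) = (\<Sum>x\<in>B. if x = b then b else 0)"
        by (intro sum.cong) auto
      also have "\<dots> = b" using fin b by simp
      finally have "is_coords_mod Q B (T b) (\<lambda>x. if x = b then 1 else 0)"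
        using b T[OF bP] by (simp add: is_coords_mod_def)
      with uniq have "(THE c. is_coords_mod Q B (T b) c) = (\<lambda>x. if x = b then 1 else 0)"
        by (intro the1_equality)
      then show ?thesis by simp
    qed
    then show ?thesis by simp
  qed
  moreover have "card B' = card B" if "basis_mod P Q B'" for B'
    using basis_mod_card_le[OF P Q(1)] B that by (blast intro: le_antisym)
  ultimately show ?thesis
    unfolding quot_trace_def by (intro the_equality) (use B in \<open>metis, metis\<close>)
qed

lemma basis_mod_span:
  assumes "finite B" "pvs.independent B"
  shows "basis_mod (pvs.span B) {0} B"
  unfolding basis_mod_def
proof (intro conjI ballI)
  show "B \<subseteq> pvs.span B" by (rule pvs.span_superset)
next
  fix p assume "p \<in> pvs.span B"
  then obtain u where u: "p = (\<Sum>b\<in>B. pscale (u b) b)"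
    unfolding pvs.span_finite[OF assms(1)] by blast
  show "\<exists>!c. is_coords_mod {0} B p c"
  proof (rule ex1I)
    show "is_coords_mod {0} B p (\<lambda>b. if b \<in> B then u b else 0)"
      by (simp add: is_coords_mod_def u)
  next
    fix c assume c: "is_coords_mod {0} B p c"
    then have "(\<Sum>b\<in>B. pscale (u b - c b) b) = 0"
      by (simp add: is_coords_mod_def u pvs.scale_left_diff_distrib sum_subtractf)
    then have "u b = c b" if "b \<in> B" for b
      using pvs.independentD[OF assms(2,1) order_refl _ that] by fastforce
    then show "c = (\<lambda>b. if b \<in> B then u b else 0)"
      using c by (auto simp: is_coords_mod_def fun_eq_iff)
  qed
qed (rule assms)

lemma quot_trace_span:
  fixes S :: "('k \<Rightarrow>\<^sub>0 'f::field) set"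
  assumes "finite S" "\<And>p. p \<in> pvs.span S \<Longrightarrow> T p = p" "B \<subseteq> S" "pvs.independent B" "S \<subseteq> pvs.span B"
  shows "quot_trace (pvs.span S) {0} T = of_nat (card B)"
proof -
  have "finite B" using assms(1,3) by (rule finite_subset[rotated])
  moreover have "pvs.span B = pvs.span S"
    using assms(3,5) pvs.span_eq pvs.span_superset by blast
  ultimately have "basis_mod (pvs.span S) {0} B"
    using basis_mod_span[of B] assms(4) by simp
  then show ?thesis
    by (rule quot_trace_eq[rotated 3])
      (use assms(2) in \<open>auto simp: pvs.span_zero pvs.subspace_def intro: pvs.span_add pvs.span_scale\<close>)
qed


section \<open>Degrees of characters of symmetric groups\<close>

lemma finite_row_stab: "finite (row_stab p)" and finite_col_stab: "finite (col_stab p)"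
  unfolding row_stab_def col_stab_def
  by (rule finite_subset[OF _ finite_permutations[of "{..<sum_list p}"]]; auto)+

text \<open>This makes the truncated subtraction in \<open>tab_col\<close> exact, so that row and
  column together determine an entry.\<close>

lemma tab_row_le:
  assumes "k < sum_list p"
  shows "sum_list (take (tab_row p k) p) \<le> k"
proof (cases "tab_row p k")
  case (Suc i)
  then have "\<not> k < sum_list (take (Suc i) p)"
    unfolding tab_row_def by (intro not_less_Least) simp
  then show ?thesis by (simp add: Suc)
qed simp

text \<open>Since \<open>\<sigma>\<close> preserves rows and brings \<open>\<tau> k\<close> back to
  \<open>k\<close>, the permutation \<open>\<tau>\<close> preserves rows as well as columns, hence
  every cell.\<close>

lemma row_col_stab_trivial:
  assumes "\<sigma> \<in> row_stab p" "\<tau> \<in> col_stab p" "\<sigma> \<circ> \<tau> = id"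
  shows "\<sigma> = id" "\<tau> = id"
proof -
  have \<sigma>: "\<sigma> permutes {..<sum_list p}" "\<And>k. k < sum_list p \<Longrightarrow> tab_row p (\<sigma> k) = tab_row p k"
    and \<tau>: "\<tau> permutes {..<sum_list p}" "\<And>k. k < sum_list p \<Longrightarrow> tab_col p (\<tau> k) = tab_col p k"
    using assms by (auto simp: row_stab_def col_stab_def)
  have "\<tau> k = k" for k
  proof (cases "k < sum_list p")
    case True
    then have k: "\<tau> k < sum_list p" using permutes_in_image[OF \<tau>(1)] by simp
    have "\<sigma> (\<tau> k) = k" using assms(3) by (metis comp_apply id_apply)
    then have "tab_row p (\<tau> k) = tab_row p k" using \<sigma>(2)[OF k] by simp
    moreover have "tab_col p (\<tau> k) = tab_col p k" using \<tau>(2)[OF True] .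
    ultimately show ?thesis
      using tab_row_le[OF k] tab_row_le[OF True] by (simp add: tab_col_def)
  next
    case False
    then show ?thesis using permutes_not_in[OF \<tau>(1)] by simp
  qed
  then show "\<tau> = id" by auto
  with assms(3) show "\<sigma> = id" by simp
qed

text \<open>Only the pair of identities has the identity as its product, and its sign is 1. In
  particular the symmetrizer is nonzero.\<close>

lemma lookup_young_symmetrizer_id:
  "Poly_Mapping.lookup (young_symmetrizer p :: _ \<Rightarrow>\<^sub>0 'f::field) id = 1"
proof -
  have id: "id \<in> row_stab p" "id \<in> col_stab p"
    by (auto simp: row_stab_def col_stab_def permutes_id)
  have "Poly_Mapping.lookup (young_symmetrizer p :: _ \<Rightarrow>\<^sub>0 'f) id =
      (\<Sum>\<sigma>\<in>row_stab p. \<Sum>\<tau>\<in>col_stab p. (of_int (sign \<tau>) when \<sigma> \<circ> \<tau> = id))"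
    by (simp add: young_symmetrizer_def lookup_sum lookup_single)
  also have "\<dots> = (\<Sum>\<sigma>\<in>row_stab p. \<Sum>\<tau>\<in>col_stab p. if \<tau> = id then (if \<sigma> = id then 1 else 0) else 0)"
    using row_col_stab_trivial[of _ p] by (intro sum.cong) (auto simp: when_def sign_id)
  also have "\<dots> = 1"
    using id finite_row_stab[of p] finite_col_stab[of p] by simp
  finally show ?thesis .
qed

lemma pushforward_id: "pushforward ((\<circ>) id) p = p"
  by (simp add: pushforward_def sum_singles)

lemma specht_generators_finite:
  "finite {pushforward ((\<circ>) \<pi>) (young_symmetrizer p :: _ \<Rightarrow>\<^sub>0 'f::field) | \<pi>. \<pi> permutes {..<sum_list p}}"
  using finite_permutations[of "{..<sum_list p}"] by (simp add: setcompr_eq_image)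

text \<open>The value at the identity is the dimension of the Specht module, which is positive
  because the module contains the nonzero symmetrizer.\<close>

lemma sym_char_id:
  obtains d where "0 < d" "(sym_char p id :: 'f::field) = of_nat d"
proof -
  let ?S = "{pushforward ((\<circ>) \<pi>) (young_symmetrizer p :: _ \<Rightarrow>\<^sub>0 'f) | \<pi>. \<pi> permutes {..<sum_list p}}"
  obtain B where B: "B \<subseteq> ?S" "pvs.independent B" "?S \<subseteq> pvs.span B"
    using pvs.maximal_independent_subset[of ?S] by blast
  have "young_symmetrizer p \<in> ?S"
    using permutes_id by (auto intro!: exI[of _ id] simp: pushforward_id)
  moreover have "young_symmetrizer p \<noteq> (0 :: _ \<Rightarrow>\<^sub>0 'f)"
    using lookup_young_symmetrizer_id[of p, where 'f='f] by auto
  ultimately have "B \<noteq> {}" using B(3) by auto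
  moreover have "finite B" using B(1) specht_generators_finite by (rule finite_subset)
  ultimately have "0 < card B" by (simp add: card_gt_0_iff)
  moreover have "sym_char p id = (of_nat (card B) :: 'f)"
    unfolding sym_char_def specht_module_def
    by (rule quot_trace_span[OF specht_generators_finite _ B]) (rule pushforward_id)
  ultimately show thesis by (rule that)
qed

lemma one_row_sum [simp]: "sum_list (one_row m) = m"
  by (simp add: one_row_def)

lemma tab_row_one_row: "k < m \<Longrightarrow> tab_row (one_row m) k = 0"
  unfolding tab_row_def by (rule Least_eq_0) (simp add: one_row_def)

text \<open>In a one-row tableau every permutation preserves the row, while each column holds a
  single entry.\<close>

lemma young_symmetrizer_one_row:
  "young_symmetrizer (one_row m) = (\<Sum>\<sigma>\<in>{\<sigma>. \<sigma> permutes {..<m}}. Poly_Mapping.single \<sigma> 1)"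
proof -
  have "row_stab (one_row m) = {\<sigma>. \<sigma> permutes {..<m}}"
    using tab_row_one_row by (auto simp: row_stab_def dest: permutes_in_image)
  moreover have "col_stab (one_row m) = {id}"
  proof -
    have col: "tab_col (one_row m) k = k" if "k < m" for k
      by (simp add: tab_col_def tab_row_one_row[OF that])
    have "\<tau> = id" if \<tau>: "\<tau> \<in> col_stab (one_row m)" for \<tau>
    proof
      fix k
      have perm: "\<tau> permutes {..<m}" using \<tau> by (simp add: col_stab_def)
      show "\<tau> k = id k"
      proof (cases "k < m")
        case True
        then have "\<tau> k < m" using permutes_in_image[OF perm] by simp
        then show ?thesis using \<tau> True by (auto simp: col_stab_def col)
      qed (use permutes_not_in[OF perm] in simp)
    qed
    then show ?thesis by (auto simp: col_stab_def permutes_id)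
  qed
  ultimately show ?thesis by (simp add: young_symmetrizer_def sign_id)
qed

text \<open>Left multiplication only reindexes the sum over all permutations, so the module is a
  line with trivial action.\<close>

lemma sym_char_one_row:
  assumes "\<pi> permutes {..<m}"
  shows "sym_char (one_row m) \<pi> = (1 :: 'f::field)"
proof -
  let ?y = "young_symmetrizer (one_row m) :: _ \<Rightarrow>\<^sub>0 'f"
  have inv: "pushforward ((\<circ>) \<rho>) ?y = ?y" if "\<rho> permutes {..<m}" for \<rho>
    unfolding young_symmetrizer_one_row
    by (simp add: pushforward_linear flip: setum_permutations_compose_left[OF that, of "\<lambda>\<sigma>. Poly_Mapping.single \<sigma> 1"])
  have "{pushforward ((\<circ>) \<rho>) ?y | \<rho>. \<rho> permutes {..<sum_list (one_row m)}} = {?y}"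
    using inv permutes_id by (auto intro!: exI[of _ id])
  then have "sym_char (one_row m) \<pi> = quot_trace (pvs.span {?y}) {0} (pushforward ((\<circ>) \<pi>))"
    by (simp add: sym_char_def specht_module_def)
  also have "\<dots> = of_nat (card {?y})"
  proof (rule quot_trace_span)
    show "pvs.independent {?y}"
      using lookup_young_symmetrizer_id[of "one_row m", where 'f='f] by auto
    fix p assume "p \<in> pvs.span {?y}"
    then show "pushforward ((\<circ>) \<pi>) p = p"
      by (auto simp: pvs.span_singleton pushforward_linear inv[OF assms])
  qed (auto intro: pvs.span_base)
  finally show ?thesis by simp
qed

lemma outer_char_one_row:
  "outer_char (\<lambda>t. one_row (\<nu> t)) = (\<lambda>\<sigma>. if \<sigma> \<in> sym_prod \<nu> then 1 else (0 :: 'f::field))"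
  unfolding outer_char_def one_row_sum
  by (auto simp: fun_eq_iff sym_prod_def intro!: prod.neutral sym_char_one_row)

lemma id_sym_prod: "(\<lambda>t. id) \<in> sym_prod \<nu>"
  by (simp add: sym_prod_def permutes_id)

lemma outer_char_id:
  fixes \<Lambda> :: "'g::finite \<times> pm \<Rightarrow> nat list"
  obtains d where "0 < d" "(outer_char \<Lambda> (\<lambda>t. id) :: 'f::field) = of_nat d"
proof -
  have "\<forall>t. \<exists>d. 0 < d \<and> (sym_char (\<Lambda> t) id :: 'f) = of_nat d" by (metis sym_char_id)
  then obtain d where d: "\<And>t. 0 < d t" "\<And>t. (sym_char (\<Lambda> t) id :: 'f) = of_nat (d t)" by metis
  have "(outer_char \<Lambda> (\<lambda>t. id) :: 'f) = of_nat (\<Prod>t\<in>UNIV. d t)"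
    by (simp add: outer_char_def id_sym_prod d(2))
  moreover have "0 < (\<Prod>t\<in>UNIV. d t)" using d(1) by (intro prod_pos) auto
  ultimately show thesis using that by blast
qed

lemma finite_partitions: "finite (partitions n)"
proof (rule finite_subset)
  show "partitions n \<subseteq> {p. set p \<subseteq> {..n} \<and> length p \<le> n}"
  proof clarify
    fix p assume p: "p \<in> partitions n"
    have "length p \<le> sum_list p" if "0 \<notin> set p" for p :: "nat list"
      using that by (induction p) auto
    then show "set p \<subseteq> {..n} \<and> length p \<le> n"
      using p member_le_sum_list[of _ p] by (auto simp: partitions_def)
  qed
  show "finite {p. set p \<subseteq> {..n} \<and> length p \<le> n}" by (rule finite_lists_length_le) simp
qed

text \<open>The sums in \<open>num_constituents\<close> run over this set; over an infinite set they
  would be 0 by convention.\<close>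

lemma finite_multipartitions:
  fixes \<nu> :: "'g::finite \<times> pm \<Rightarrow> nat"
  shows "finite (multipartitions \<nu>)"
proof -
  have "multipartitions \<nu> = Pi UNIV (\<lambda>t. partitions (\<nu> t))"
    by (auto simp: multipartitions_def)
  also have "\<dots> = PiE UNIV (\<lambda>t. partitions (\<nu> t))" by (simp add: PiE_def extensional_def)
  also have "finite \<dots>" by (rule finite_PiE) (simp_all add: finite_partitions)
  finally show ?thesis .
qed

text \<open>Characters take positive integer values at the identity, so a decomposition of a character
  of degree at most one has that degree as its sum of multiplicities.\<close>

lemma multiplicities_sum:
  fixes \<nu> :: "'g::finite \<times> pm \<Rightarrow> nat" and \<psi> :: "_ \<Rightarrow> 'f::field_char_0"
  assumes \<psi>: "\<psi> = (\<lambda>\<sigma>. \<Sum>\<Lambda>\<in>multipartitions \<nu>. of_nat (m \<Lambda>) * outer_char \<Lambda> \<sigma>)"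
    and deg: "\<psi> (\<lambda>t. id) = of_nat k" and k: "k \<le> 1"
  shows "(\<Sum>\<Lambda>\<in>multipartitions \<nu>. m \<Lambda>) = k"
proof -
  have "\<forall>\<Lambda>. \<exists>d. 0 < d \<and> (outer_char (\<Lambda> :: 'g \<times> pm \<Rightarrow> nat list) (\<lambda>t. id) :: 'f) = of_nat d"
    by (metis outer_char_id)
  then obtain d where d: "\<And>\<Lambda>. 0 < d \<Lambda>"
      "\<And>\<Lambda> :: 'g \<times> pm \<Rightarrow> nat list. (outer_char \<Lambda> (\<lambda>t. id) :: 'f) = of_nat (d \<Lambda>)" by metis
  have "(of_nat (\<Sum>\<Lambda>\<in>multipartitions \<nu>. m \<Lambda> * d \<Lambda>) :: 'f) = of_nat k"
    using fun_cong[OF \<psi>, of "\<lambda>t. id"] by (simp add: deg d(2))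
  then have k_eq: "(\<Sum>\<Lambda>\<in>multipartitions \<nu>. m \<Lambda> * d \<Lambda>) = k" by (simp only: of_nat_eq_iff)
  have "m \<Lambda> * 1 \<le> m \<Lambda> * d \<Lambda>" for \<Lambda> using d(1)[of \<Lambda>] by (intro mult_left_mono) auto
  then have "(\<Sum>\<Lambda>\<in>multipartitions \<nu>. m \<Lambda>) \<le> k"
    unfolding k_eq[symmetric] by (intro sum_mono) simp
  \<comment> \<open>A vanishing total multiplicity forces degree 0; together with the upper bound
    and \<open>k \<le> 1\<close> this leaves only \<open>k\<close>.\<close>
  moreover have "k = 0" if "(\<Sum>\<Lambda>\<in>multipartitions \<nu>. m \<Lambda>) = 0"
    using that k_eq by (simp add: finite_multipartitions)
  ultimately show ?thesis using k by linarith
qed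

lemma num_constituents_zero:
  fixes \<nu> :: "'g::finite \<times> pm \<Rightarrow> nat"
  shows "num_constituents \<nu> ((\<lambda>_. 0) :: _ \<Rightarrow> 'f::field_char_0) = 0"
  unfolding num_constituents_def
proof (rule the_equality)
  show "\<exists>m. (\<lambda>_. 0 :: 'f) = (\<lambda>\<sigma>. \<Sum>\<Lambda>\<in>multipartitions \<nu>. of_nat (m \<Lambda>) * outer_char \<Lambda> \<sigma>) \<and>
      0 = (\<Sum>\<Lambda>\<in>multipartitions \<nu>. m \<Lambda>)"
    by (rule exI[of _ "\<lambda>_. 0"]) simp
qed (use multiplicities_sum[where k = 0 and \<psi> = "\<lambda>_. 0 :: 'f"] in auto)

lemma num_constituents_one_row:
  fixes \<nu> :: "'g::finite \<times> pm \<Rightarrow> nat"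
  shows "num_constituents \<nu> (outer_char (\<lambda>t. one_row (\<nu> t)) :: _ \<Rightarrow> 'f::field_char_0) = 1"
  unfolding num_constituents_def
proof (rule the_equality)
  let ?\<Lambda> = "\<lambda>t. one_row (\<nu> t)"
  have \<Lambda>: "?\<Lambda> \<in> multipartitions \<nu>"
    by (auto simp: multipartitions_def partitions_def one_row_def)
  show "\<exists>m. (outer_char ?\<Lambda> :: _ \<Rightarrow> 'f) = (\<lambda>\<sigma>. \<Sum>\<Lambda>\<in>multipartitions \<nu>. of_nat (m \<Lambda>) * outer_char \<Lambda> \<sigma>) \<and>
      1 = (\<Sum>\<Lambda>\<in>multipartitions \<nu>. m \<Lambda>)"
    by (rule exI[of _ "\<lambda>\<Lambda>. if \<Lambda> = ?\<Lambda> then 1 else 0"])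
      (simp add: finite_multipartitions \<Lambda> if_distrib if_distribR cong: if_cong)
  fix k assume "\<exists>m. (outer_char ?\<Lambda> :: _ \<Rightarrow> 'f) =
      (\<lambda>\<sigma>. \<Sum>\<Lambda>\<in>multipartitions \<nu>. of_nat (m \<Lambda>) * outer_char \<Lambda> \<sigma>) \<and>
      k = (\<Sum>\<Lambda>\<in>multipartitions \<nu>. m \<Lambda>)"
  then obtain m where m: "(outer_char ?\<Lambda> :: _ \<Rightarrow> 'f) =
      (\<lambda>\<sigma>. \<Sum>\<Lambda>\<in>multipartitions \<nu>. of_nat (m \<Lambda>) * outer_char \<Lambda> \<sigma>)"
      "k = (\<Sum>\<Lambda>\<in>multipartitions \<nu>. m \<Lambda>)" by blast
  have "(outer_char ?\<Lambda> (\<lambda>t. id) :: 'f) = of_nat 1"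
    by (simp add: outer_char_one_row id_sym_prod)
  from multiplicities_sum[OF m(1) this] show "k = 1" by (simp add: m(2))
qed


section \<open>Independence of monomials\<close>

text \<open>Dedekind's argument: monomials are multiplicative in the point of evaluation, and distinct
  ones are separated by the powers of two.\<close>

lemma monomials_independent:
  fixes c :: "'v multiset \<Rightarrow> 'f::field_char_0"
  assumes "finite \<M>" "\<And>x. (\<Sum>M\<in>\<M>. c M * prod_mset (image_mset x M)) = 0" "M \<in> \<M>"
  shows "c M = 0"
  using assms
proof (induction \<M> arbitrary: c M rule: finite_induct)
  case (insert N \<M>)
  let ?m = "\<lambda>x M. prod_mset (image_mset x M) :: 'f"
  have mult: "?m (\<lambda>v. x v * y v) M = ?m x M * ?m y M" for x y M
    by (induction M) (simp_all add: mult_ac)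
  have sum: "(\<Sum>M\<in>\<M>. c M * ?m x M) = - (c N * ?m x N)" for x
    using insert.prems(1)[of x] insert.hyps by (simp add: eq_neg_iff_add_eq_0 add.commute)
  have two: "(2 :: 'f) ^ a = 2 ^ b \<longleftrightarrow> a = b" for a b
  proof -
    have "(2 :: 'f) ^ a = 2 ^ b \<longleftrightarrow> (of_nat (2 ^ a) :: 'f) = of_nat (2 ^ b)" by simp
    also have "\<dots> \<longleftrightarrow> a = b" unfolding of_nat_eq_iff by simp
    finally show ?thesis .
  qed
  have zero: "c M = 0" if M: "M \<in> \<M>" for M
  proof -
    from M insert.hyps have "M \<noteq> N" by auto
    then obtain v where v: "count M v \<noteq> count N v" by (auto simp: multiset_eq_iff)
    define y where "y = (\<lambda>u. if u = v then 2 else 1 :: 'f)"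
    have y: "?m y L = 2 ^ count L v" for L by (induction L) (auto simp: y_def)
    \<comment> \<open>Take the relation at the product of the points \<open>x\<close> and
      \<open>y\<close> and subtract \<open>?m y N\<close> times the relation at \<open>x\<close>:
      the term of \<open>N\<close> cancels, and a relation over the smaller set remains.\<close>
    have "c M * (?m y M - ?m y N) = 0"
    proof (rule insert.IH[OF _ M])
      fix x
      have "(\<Sum>M\<in>\<M>. c M * (?m y M - ?m y N) * ?m x M) =
          (\<Sum>M\<in>\<M>. c M * ?m (\<lambda>v. x v * y v) M) - ?m y N * (\<Sum>M\<in>\<M>. c M * ?m x M)"
        by (simp add: mult sum_distrib_left sum_subtractf[symmetric] algebra_simps)
      also have "\<dots> = 0" by (simp only: sum) (simp add: mult)
      finally show "(\<Sum>M\<in>\<M>. c M * (?m y M - ?m y N) * ?m x M) = 0" .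
    qed
    moreover have "?m y M \<noteq> ?m y N"
      using v by (simp add: y two)
    ultimately show ?thesis by simp
  qed
  \<comment> \<open>At the constant point 1 every monomial has value 1, so only \<open>c N\<close>
    is left.\<close>
  moreover have "c N = 0" using sum[of "\<lambda>_. 1"] by (simp add: zero)
  ultimately show ?case using insert.prems(2) by auto
qed simp

lemma lookup_pushforward:
  "Poly_Mapping.lookup (pushforward \<phi> f) l =
    (\<Sum>k\<in>{k \<in> Poly_Mapping.keys f. \<phi> k = l}. Poly_Mapping.lookup f k)"
  by (simp add: pushforward_def lookup_sum lookup_single when_def sum.If_cases Int_def)

text \<open>Applied to \<open>gwt\<close> and \<open>hwt\<close>: a word of total weight at least 2
  contains two letters whose product already lies in the ideal.\<close>

lemma sum_mset_ge_2E:
  fixes f :: "'a \<Rightarrow> nat"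
  assumes "2 \<le> (\<Sum>v\<in>#M. f v)" "\<And>v. f v \<le> 1"
  obtains u v N where "M = add_mset u (add_mset v N)" "f u = 1" "f v = 1"
proof -
  have ex: "\<exists>u N. M = add_mset u N \<and> f u = 1" if "0 < (\<Sum>v\<in>#M. f v)" for M
  proof -
    have "\<exists>u\<in>#M. f u \<noteq> 0"
    proof (rule ccontr)
      assume "\<not> ?thesis"
      then have "(\<Sum>v\<in>#M. f v) = 0" by (intro sum_mset.neutral) auto
      with that show False by simp
    qed
    then obtain u where "u \<in># M" "f u \<noteq> 0" by blast
    then have "f u = 1" "\<exists>N. M = add_mset u N"
      using assms(2)[of u] multi_member_split by (auto simp: le_Suc_eq)
    then show ?thesis by blast
  qed
  obtain u N where u: "M = add_mset u N" "f u = 1" using ex[of M] assms(1) by auto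
  then obtain v N' where "N = add_mset v N'" "f v = 1" using ex[of N] assms(1) by auto
  with u that show thesis by blast
qed


section \<open>The algebras W\<close>

fun pm_times :: "pm \<Rightarrow> pm \<Rightarrow> pm" where
  "pm_times Plus e = e"
| "pm_times Minus Plus = Minus"
| "pm_times Minus Minus = Plus"

lemma pm_val_times: "pm_val (pm_times d e) = pm_val d * pm_val e"
  by (cases d; cases e) simp_all

lemma pm_times_Minus_neq [simp]: "pm_times Minus e \<noteq> e" "e \<noteq> pm_times Minus e"
  by (cases e; simp)+

lemma pm_times_Plus [simp]: "pm_times e Plus = e"
  by (cases e) simp_all

lemma pm_times_commute: "pm_times d e = pm_times e d"
  by (cases d; cases e) simp_all

text \<open>The monomial x^i y^j when W is identified with F[x, y]/(x^2, y^2) through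
  \<open>W1\<close> = x, \<open>W2\<close> = y, \<open>W3\<close> = xy; an exponent above 1 gives
  zero.\<close>

definition W_monomial :: "nat \<Rightarrow> nat \<Rightarrow> 'f::field mat4"
  where "W_monomial i j = W_elt (of_bool (i = 0 \<and> j = 0)) (of_bool (i = 1 \<and> j = 0))
    (of_bool (i = 0 \<and> j = 1)) (of_bool (i = 1 \<and> j = 1))"

lemma W_monomial_mult: "W_monomial i j ** W_monomial k l = W_monomial (i + k) (j + l)"
  unfolding W_monomial_def W_elt_mult W_elt_inject
  by (auto simp: of_bool_def)

text \<open>The first row of an element of W lists its coordinates, so one matrix entry isolates one
  monomial.\<close>

lemma W_monomial_entry:
  assumes "i \<le> 1" "j \<le> 1"
  shows "W_monomial k l $ 1 $ (if j = 0 then if i = 0 then 1 else 2 else if i = 0 then 3 else 4) =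
    of_bool (k = i \<and> l = j)"
proof -
  from assms consider "i = 0" "j = 0" | "i = 1" "j = 0" | "i = 0" "j = 1" | "i = 1" "j = 1" by linarith
  then show ?thesis by cases (simp_all add: W_monomial_def W_elt_entries)
qed

text \<open>The parameters \<open>s\<close> and \<open>t\<close> are the signs of \<open>W1\<close>
  and \<open>W2\<close>; since \<open>W3\<close> is their product in a commutative algebra, its sign
  is the product of signs. The involutions \<open>nu1\<close>, \<open>nu2\<close>,
  \<open>nu3\<close> are the cases (Plus, Plus), (Minus, Minus), (Minus, Plus).\<close>

locale W_grading =
  fixes g h :: "'g::{finite,ab_group_add}" and s t :: pm and \<nu> :: "'f::field_char_0 mat4 \<Rightarrow> 'f mat4"
  assumes distinct: "g \<noteq> 0" "h \<noteq> 0" "g \<noteq> h" "g + h \<noteq> 0"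
    and \<nu>: "\<nu> \<in> {nu1, nu2, nu3}"
    and \<nu>_W_elt: "\<nu> (W_elt a b c d) =
      W_elt a (pm_val s * b) (pm_val t * c) (pm_val (pm_times s t) * d)"
begin

lemma degrees_distinct [simp]:
  "g \<noteq> 0" "h \<noteq> 0" "g \<noteq> h" "g + h \<noteq> 0" "g + h \<noteq> g" "g + h \<noteq> h"
  "0 \<noteq> g" "0 \<noteq> h" "h \<noteq> g" "0 \<noteq> g + h" "g \<noteq> g + h" "h \<noteq> g + h"
  using distinct by auto

text \<open>The last \<open>Plus\<close> is the sign of the unit in degree 0. Outside the support it
  is only a default, as \<open>good_type\<close> rejects such degrees anyway.\<close>

definition sgn_of :: "'g \<Rightarrow> pm"
  where "sgn_of k = (if k = g then s else if k = h then t else if k = g + h then pm_times s t else Plus)"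

definition good_type :: "'g \<times> pm \<Rightarrow> bool"
  where "good_type p \<longleftrightarrow> fst p \<in> {0, g, h, g + h} \<and> snd p = sgn_of (fst p)"

text \<open>\<open>gwt\<close> and \<open>hwt\<close> are the exponents of x and y in the monomial
  spanning the component of degree \<open>k\<close>, with value 0 outside the support.\<close>

definition gwt :: "'g \<Rightarrow> nat" where "gwt k = of_bool (k = g \<or> k = g + h)"
definition hwt :: "'g \<Rightarrow> nat" where "hwt k = of_bool (k = h \<or> k = g + h)"

abbreviation good_var :: "'g var \<Rightarrow> bool"
  where "good_var v \<equiv> good_type (vdeg v, vsgn v)"

definition good :: "'g var multiset \<Rightarrow> bool"
  where "good M \<longleftrightarrow> (\<forall>v\<in>#M. good_var v) \<and>
    (\<Sum>v\<in>#M. gwt (vdeg v)) \<le> 1 \<and> (\<Sum>v\<in>#M. hwt (vdeg v)) \<le> 1"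

text \<open>The products are, up to order, all pairs of good types for which the two values of
  \<open>gwt\<close> or the two values of \<open>hwt\<close> add up to 2.\<close>

definition gens :: "('f, 'g) free set"
  where "gens = {X 0 k e | k e. \<not> good_type (k, e)} \<union>
    {X 0 g s * X 1 g s, X 0 h t * X 1 h t,
     X 0 (g + h) (pm_times s t) * X 1 (g + h) (pm_times s t),
     X 0 g s * X 1 (g + h) (pm_times s t), X 0 h t * X 1 (g + h) (pm_times s t)}"

section \<open>Reduction to good multisets modulo a T-ideal containing the generators\<close>

context
  fixes I :: "('f, 'g) free set"
  assumes I: "T_ideal I" and gens: "gens \<subseteq> I"
begin

lemma bad_var_mem: "\<not> good_var v \<Longrightarrow> Poly_Mapping.single [v] 1 \<in> I"
proof -
  assume "\<not> good_var v"
  then have "X 0 (vdeg v) (vsgn v) \<in> I" using gens by (auto simp: gens_def)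
  from T_ideal_X_subst[OF I this X_free_cmp free_star_X] show ?thesis
    by (metis X_var)
qed

text \<open>Each product is a generator in one order only. The involution reverses it up to the sign
  \<open>?c\<close>, which squares to 1.\<close>

lemma pair_swap:
  assumes "Poly_Mapping.single [u, v] 1 \<in> I"
  shows "Poly_Mapping.single [v, u] 1 \<in> I"
proof -
  let ?c = "pm_val (vsgn u) * pm_val (vsgn v) :: 'f"
  have "pscale ?c (free_star (Poly_Mapping.single [u, v] 1)) \<in> I"
    by (intro pvs.subspace_scale[OF T_ideal_subspace[OF I]] T_ideal_star[OF I] assms)
  moreover have "?c * ?c = 1"
    by (simp add: pm_val_times[symmetric])
  ultimately show ?thesis by simp
qed

lemma pair_mem_X:
  "X 0 (vdeg u) (vsgn u) * X 1 (vdeg v) (vsgn v) \<in> I \<Longrightarrow> Poly_Mapping.single [u, v] 1 \<in> I"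
  using T_ideal_X_mult_rename[OF I, of "vdeg u" "vsgn u" "vdeg v" "vsgn v" "vnum u" "vnum v"]
  by (simp add: X_mult)

lemma pair_mem:
  assumes "good_var u" "good_var v"
    and "2 \<le> gwt (vdeg u) + gwt (vdeg v) \<or> 2 \<le> hwt (vdeg u) + hwt (vdeg v)"
  shows "Poly_Mapping.single [u, v] 1 \<in> I"
proof -
  have deg: "vdeg u \<in> {0, g, h, g + h}" "vdeg v \<in> {0, g, h, g + h}"
    and sgn: "vsgn u = sgn_of (vdeg u)" "vsgn v = sgn_of (vdeg v)"
    using assms(1,2) by (auto simp: good_type_def)
  have gen: "X 0 g s * X 1 g s \<in> I" "X 0 h t * X 1 h t \<in> I"
     "X 0 (g + h) (pm_times s t) * X 1 (g + h) (pm_times s t) \<in> I"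
     "X 0 g s * X 1 (g + h) (pm_times s t) \<in> I" "X 0 h t * X 1 (g + h) (pm_times s t) \<in> I"
    using gens by (auto simp: gens_def)
  have "X 0 (vdeg u) (vsgn u) * X 1 (vdeg v) (vsgn v) \<in> I \<or>
      X 0 (vdeg v) (vsgn v) * X 1 (vdeg u) (vsgn u) \<in> I"
    unfolding sgn using deg assms(3) gen
    by (elim insertE emptyE) (simp_all add: sgn_of_def gwt_def hwt_def)
  then show ?thesis using pair_mem_X pair_swap by blast
qed

text \<open>The commutator of variables of signs \<open>d\<close> and \<open>e\<close> has sign \<open>- d e\<close>, which is the sign
  without nonzero values whenever the product is not already in the ideal.\<close>

lemma commutator_mem: "Poly_Mapping.single [u, v] 1 - Poly_Mapping.single [v, u] 1 \<in> I"
proof -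
  note sub = T_ideal_subspace[OF I]
  have prod: "Poly_Mapping.single [u, v] 1 = Poly_Mapping.single [u] 1 * (Poly_Mapping.single [v] 1 :: ('f, 'g) free)"
    for u v by (simp add: mult_single plus_list_def)
  consider (bad) "\<not> good_var u \<or> \<not> good_var v"
    | (pair) "good_var u" "good_var v"
        "2 \<le> gwt (vdeg u) + gwt (vdeg v) \<or> 2 \<le> hwt (vdeg u) + hwt (vdeg v)"
    | (commute) "good_var u" "good_var v"
        "gwt (vdeg u) + gwt (vdeg v) < 2" "hwt (vdeg u) + hwt (vdeg v) < 2"
    by linarith
  then show ?thesis
  proof cases
    case bad
    then have "Poly_Mapping.single [u] 1 \<in> I \<or> Poly_Mapping.single [v] 1 \<in> I"
      using bad_var_mem by blast
    then show ?thesis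
      unfolding prod using T_ideal_mult[OF I] by (intro pvs.subspace_diff[OF sub]) auto
  next
    case pair
    note uv = pair_mem[OF pair]
    show ?thesis by (rule pvs.subspace_diff[OF sub uv pair_swap[OF uv]])
  next
    case commute
    let ?q = "Poly_Mapping.single [u, v] 1 - Poly_Mapping.single [v, u] 1 :: ('f, 'g) free"
    let ?k = "vdeg u + vdeg v" and ?e = "pm_times Minus (pm_times (vsgn u) (vsgn v))"
    have deg: "vdeg u \<in> {0, g, h, g + h}" "vdeg v \<in> {0, g, h, g + h}"
      and sgn: "vsgn u = sgn_of (vdeg u)" "vsgn v = sgn_of (vdeg v)"
      using commute(1,2) by (auto simp: good_type_def)
    \<comment> \<open>The weight bounds leave only these pairs of degrees, and for them the signs
      multiply to the sign attached to the degree of the product.\<close>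
    have "vdeg u = 0 \<or> vdeg v = 0 \<or> vdeg u = g \<and> vdeg v = h \<or> vdeg u = h \<and> vdeg v = g"
      using deg commute(3,4) by (auto simp: gwt_def hwt_def)
    then have "sgn_of ?k = pm_times (vsgn u) (vsgn v)"
      unfolding sgn by (elim disjE conjE) (simp_all add: sgn_of_def add.commute[of h g] pm_times_commute[of t s])
    then have "\<not> good_type (?k, ?e)" by (simp add: good_type_def)
    then have "X 0 ?k ?e \<in> I" using gens by (auto simp: gens_def)
    moreover have "?q \<in> free_cmp ?k"
      using free_cmp_single[of "[u, v]" 1] free_cmp_single[of "[v, u]" 1]
      by (intro pvs.subspace_diff[OF free_cmp_subspace]) (auto simp: add.commute)
    \<comment> \<open>The involution exchanges the two words and multiplies both by the product of
      the two signs.\<close>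
    moreover have "free_star ?q = pscale (pm_val ?e) ?q"
      unfolding pm_val_times
      by (simp add: free_star_linear pvs.scale_right_diff_distrib mult.commute single_uminus)
    ultimately show ?thesis by (rule T_ideal_X_subst[OF I])
  qed
qed

lemma cons_mem: "Poly_Mapping.single w 1 - Poly_Mapping.single w' 1 \<in> I \<Longrightarrow>
  Poly_Mapping.single (v # w) 1 - Poly_Mapping.single (v # w') 1 \<in> I"
  using T_ideal_mult(2)[OF I, of "Poly_Mapping.single w 1 - Poly_Mapping.single w' 1"
      "Poly_Mapping.single [v] 1"]
  by (simp add: right_diff_distrib mult_single plus_list_def)

lemma mem_trans: "p - q \<in> I \<Longrightarrow> q - r \<in> I \<Longrightarrow> p - r \<in> I"
  using pvs.subspace_add[OF T_ideal_subspace[OF I], of "p - q" "q - r"] by simp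

text \<open>A letter passes a block by successive commutators. Sorting in \<open>permute_mem\<close>
  then means bringing the first letter of \<open>w\<close> to its place in
  \<open>w'\<close>.\<close>

lemma move_var_mem:
  "Poly_Mapping.single (v # us @ ws) 1 - Poly_Mapping.single (us @ v # ws) 1 \<in> I"
proof (induction us)
  case Nil
  show ?case by (simp add: pvs.subspace_0[OF T_ideal_subspace[OF I]])
next
  case (Cons u us)
  have "(Poly_Mapping.single [v, u] 1 - Poly_Mapping.single [u, v] 1) * Poly_Mapping.single (us @ ws) 1 \<in> I"
    by (intro T_ideal_mult[OF I] commutator_mem)
  then have "Poly_Mapping.single (v # u # us @ ws) 1 - Poly_Mapping.single (u # v # us @ ws) 1 \<in> I"
    by (simp add: left_diff_distrib mult_single plus_list_def)
  from mem_trans[OF this cons_mem[OF Cons.IH]] show ?case by simp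
qed

lemma permute_mem:
  "mset w = mset w' \<Longrightarrow> Poly_Mapping.single w 1 - Poly_Mapping.single w' 1 \<in> I"
proof (induction w arbitrary: w')
  case Nil
  then show ?case by (simp add: pvs.subspace_0[OF T_ideal_subspace[OF I]])
next
  case (Cons v w)
  from Cons.prems have "v \<in> set w'" by (metis list.set_intros(1) set_mset_mset)
  then obtain us ws where w': "w' = us @ v # ws" by (meson split_list)
  then have "mset w = mset (us @ ws)" using Cons.prems by simp
  from mem_trans[OF cons_mem[OF Cons.IH[OF this]] move_var_mem] show ?case by (simp add: w')
qed

lemma bad_word_mem:
  assumes "\<not> good (mset w)"
  shows "Poly_Mapping.single w 1 \<in> I"
proof (cases "\<forall>v\<in>set w. good_var v")
  case True
  then have "2 \<le> (\<Sum>v\<in>#mset w. gwt (vdeg v)) \<or> 2 \<le> (\<Sum>v\<in>#mset w. hwt (vdeg v))"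
    using assms by (auto simp: good_def)
  then obtain u v N where uv: "mset w = add_mset u (add_mset v N)"
      "2 \<le> gwt (vdeg u) + gwt (vdeg v) \<or> 2 \<le> hwt (vdeg u) + hwt (vdeg v)"
  proof
    assume "2 \<le> (\<Sum>v\<in>#mset w. gwt (vdeg v))"
    then show thesis by (rule sum_mset_ge_2E) (use that in \<open>auto simp: gwt_def\<close>)
  next
    assume "2 \<le> (\<Sum>v\<in>#mset w. hwt (vdeg v))"
    then show thesis by (rule sum_mset_ge_2E) (use that in \<open>auto simp: hwt_def\<close>)
  qed
  \<comment> \<open>The two heavy letters need not be adjacent in \<open>w\<close>; since letters
    commute modulo \<open>I\<close>, they may be moved to the front.\<close>
  obtain w' where w': "N = mset w'" by (metis ex_mset)
  have "u \<in> set w" "v \<in> set w"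
    using uv(1) by (metis set_mset_mset union_single_eq_member add_mset_commute)+
  then have "Poly_Mapping.single [u, v] 1 * Poly_Mapping.single w' 1 \<in> I"
    using True uv(2) by (intro T_ideal_mult[OF I] pair_mem) auto
  then have "Poly_Mapping.single (u # v # w') 1 \<in> I"
    by (simp add: mult_single plus_list_def)
  moreover have "Poly_Mapping.single w 1 - Poly_Mapping.single (u # v # w') 1 \<in> I"
    by (rule permute_mem) (simp add: uv w')
  ultimately show ?thesis
    using pvs.subspace_add[OF T_ideal_subspace[OF I]] by fastforce
next
  case False
  then obtain us v ws where w: "w = us @ v # ws" "\<not> good_var v" by (meson split_list)
  have "Poly_Mapping.single us 1 * (Poly_Mapping.single [v] 1 * Poly_Mapping.single ws 1) \<in> I"
    by (intro T_ideal_mult[OF I] bad_var_mem w)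
  then show ?thesis by (simp add: mult_single plus_list_def w(1))
qed

text \<open>The coefficient of \<open>pushforward mset f\<close> at \<open>M\<close> is the sum of
  the coefficients of all words with letters \<open>M\<close>. Modulo \<open>I\<close>,
  \<open>f\<close> is the combination of one representative word per multiset with these
  coefficients; good terms vanish by assumption, bad representatives lie in
  \<open>I\<close>.\<close>

lemma mem_if_good_coeffs_zero:
  fixes f :: "('f, 'g) free"
  assumes f: "\<And>M. good M \<Longrightarrow> Poly_Mapping.lookup (pushforward mset f) M = 0"
  shows "f \<in> I"
proof -
  note sub = T_ideal_subspace[OF I]
  define r where "r M = (SOME w. mset w = M)" for M :: "'g var multiset"
  have r: "mset (r M) = M" for M unfolding r_def by (rule someI_ex) (rule ex_mset)
  let ?K = "Poly_Mapping.keys f" and ?c = "Poly_Mapping.lookup f"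
  have "(\<Sum>w\<in>?K. pscale (?c w) (Poly_Mapping.single w 1 - Poly_Mapping.single (r (mset w)) 1)) \<in> I"
    by (intro pvs.subspace_sum[OF sub] pvs.subspace_scale[OF sub] permute_mem) (simp add: r)
  moreover have "(\<Sum>w\<in>?K. pscale (?c w) (Poly_Mapping.single (r (mset w)) 1)) \<in> I"
  proof -
    have "(\<Sum>w\<in>?K. pscale (?c w) (Poly_Mapping.single (r (mset w)) 1)) =
        (\<Sum>M\<in>mset ` ?K. \<Sum>w\<in>{w\<in>?K. mset w = M}. pscale (?c w) (Poly_Mapping.single (r (mset w)) 1))"
      by (rule sum.image_gen) simp
    also have "\<dots> = (\<Sum>M\<in>mset ` ?K. pscale (Poly_Mapping.lookup (pushforward mset f) M)
        (Poly_Mapping.single (r M) 1))"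
      by (intro sum.cong refl) (simp add: lookup_pushforward pvs.scale_sum_left del: pscale_single)
    also have "\<dots> \<in> I"
    proof (intro pvs.subspace_sum[OF sub])
      fix M
      show "pscale (Poly_Mapping.lookup (pushforward mset f) M) (Poly_Mapping.single (r M) 1) \<in> I"
        using f[of M] bad_word_mem[of "r M"]
        by (cases "good M") (auto simp: r pvs.subspace_0[OF sub] simp del: pscale_single
            intro!: pvs.subspace_scale[OF sub])
    qed
    finally show ?thesis .
  qed
  ultimately have "(\<Sum>w\<in>?K. pscale (?c w) (Poly_Mapping.single w 1)) \<in> I"
    using pvs.subspace_add[OF sub] by (fastforce simp: pvs.scale_right_diff_distrib sum_subtractf
        simp del: pscale_single)
  then show ?thesis by (simp add: sum_singles)
qed

end

end


lemma mscale_mult: "mscale a M ** mscale b N = mscale (a * b) (M ** N)"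
  by (simp add: mscale_def map_matrix_def matrix_matrix_mult_def vec_eq_iff sum_distrib_left mult_ac)

lemma mscale_entry: "mscale a M $ i $ j = a * M $ i $ j"
  by (simp add: mscale_def map_matrix_def)

lemma W_monomial_eq_0: "2 \<le> i \<or> 2 \<le> j \<Longrightarrow> W_monomial i j = 0"
  by (auto simp: W_monomial_def W_elt_basis)

text \<open>Opposite signs have different values because 2 is invertible; this separates symmetric
  from skew elements.\<close>

lemma pm_val_mult_eq_iff: "pm_val d * x = pm_val e * x \<longleftrightarrow> d = e \<or> x = (0 :: 'f::field_char_0)"
proof -
  have neg: "x = - x \<longleftrightarrow> x = 0" "- x = x \<longleftrightarrow> x = 0" for x :: 'f
    using mult_2[of x] by (auto simp: eq_neg_iff_add_eq_0 neg_eq_iff_add_eq_0)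
  show ?thesis by (cases d; cases e) (simp_all add: neg)
qed

section \<open>Evaluation at generic points of W\<close>

context W_grading
begin

sublocale W: gstar_algebra "W_alg \<nu> g h"
  by (rule gstar_algebra_W[OF \<nu>])

lemma W_alg_simps [simp]:
  "scl (W_alg \<nu> g h) = mscale" "mul (W_alg \<nu> g h) = (**)" "unt (W_alg \<nu> g h) = mat 1"
  "star (W_alg \<nu> g h) = \<nu>"
  by (simp_all add: W_alg_def)

lemma weights [simp]:
  "gwt 0 = 0" "gwt g = 1" "gwt h = 0" "gwt (g + h) = 1"
  "hwt 0 = 0" "hwt g = 0" "hwt h = 1" "hwt (g + h) = 1"
  "sgn_of 0 = Plus" "sgn_of g = s" "sgn_of h = t" "sgn_of (g + h) = pm_times s t"
  by (simp_all add: gwt_def hwt_def sgn_of_def)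

text \<open>The four degrees are pairwise distinct, so each component of given degree and sign is
  zero or the line through one monomial. A substitution is therefore one scalar per good
  variable.\<close>

lemma pm_cmp_W:
  "M \<in> pm_cmp (W_alg \<nu> g h) k e \<longleftrightarrow>
    (if good_type (k, e) then \<exists>a. M = mscale a (W_monomial (gwt k) (hwt k)) else M = 0)"
proof -
  have "M \<in> pm_cmp (W_alg \<nu> g h) k e \<longleftrightarrow> (\<exists>a b c d. M = W_elt a b c d \<and>
      (a \<noteq> 0 \<longrightarrow> k = 0 \<and> e = Plus) \<and> (b \<noteq> 0 \<longrightarrow> k = g \<and> e = s) \<and>
      (c \<noteq> 0 \<longrightarrow> k = h \<and> e = t) \<and> (d \<noteq> 0 \<longrightarrow> k = g + h \<and> e = pm_times s t))"
  proof -
    have star: "\<nu> (W_elt a b c d) = mscale (pm_val e) (W_elt a b c d) \<longleftrightarrow>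
        (a \<noteq> 0 \<longrightarrow> e = Plus) \<and> (b \<noteq> 0 \<longrightarrow> e = s) \<and> (c \<noteq> 0 \<longrightarrow> e = t) \<and> (d \<noteq> 0 \<longrightarrow> e = pm_times s t)"
      for a b c d
    proof -
      have a: "a = pm_val e * a \<longleftrightarrow> e = Plus \<or> a = 0"
        using pm_val_mult_eq_iff[of Plus a e] by auto
      show ?thesis unfolding \<nu>_W_elt W_elt_scale W_elt_inject pm_val_mult_eq_iff a by auto
    qed
    have "(\<exists>a b c d. M = W_elt a b c d \<and> R a b c d) \<and> \<nu> M = mscale (pm_val e) M \<longleftrightarrow>
        (\<exists>a b c d. M = W_elt a b c d \<and> R a b c d \<and>
          \<nu> (W_elt a b c d) = mscale (pm_val e) (W_elt a b c d))" for R
      by auto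
    from this[of "\<lambda>a b c d. (a \<noteq> 0 \<longrightarrow> k = 0) \<and> (b \<noteq> 0 \<longrightarrow> k = g) \<and> (c \<noteq> 0 \<longrightarrow> k = h) \<and>
        (d \<noteq> 0 \<longrightarrow> k = g + h)"]
    show ?thesis
      unfolding W.pm_cmp_iff W_cmp W_alg_simps star by (simp only: imp_conjR conj_ac)
  qed
  also have "\<dots> \<longleftrightarrow> (if good_type (k, e) then \<exists>a. M = mscale a (W_monomial (gwt k) (hwt k)) else M = 0)"
  proof -
    consider "k = 0" | "k = g" | "k = h" | "k = g + h" | "k \<notin> {0, g, h, g + h}" by blast
    then show ?thesis
    proof cases
      case 5
      then show ?thesis by (auto simp: good_type_def W_elt_basis)
    qed (simp_all add: good_type_def W_monomial_def W_elt_scale W_elt_basis)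
  qed
  finally show ?thesis .
qed

text \<open>The substitution with scalar coordinates \<open>x\<close>. A word of good variables
  evaluates to the commutative monomial of its letters in \<open>x\<close> times a monomial of
  W.\<close>

definition point :: "('g var \<Rightarrow> 'f) \<Rightarrow> 'g var \<Rightarrow> 'f mat4"
  where "point x v =
    (if good_var v then mscale (x v) (W_monomial (gwt (vdeg v)) (hwt (vdeg v))) else 0)"

lemma admissible_point: "W.admissible (point x)"
  unfolding W.admissible_def pm_cmp_W by (auto simp: point_def)

lemma word_eval_point:
  "W.word_eval (point x) w = (if \<forall>v\<in>set w. good_var v
     then mscale (\<Prod>v\<leftarrow>w. x v) (W_monomial (\<Sum>v\<leftarrow>w. gwt (vdeg v)) (\<Sum>v\<leftarrow>w. hwt (vdeg v))) else 0)"
proof (induction w)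
  case Nil
  show ?case by (simp add: W_monomial_def W_elt_basis W_elt_scale)
next
  case (Cons v w)
  then show ?case
    by (simp add: point_def mscale_mult W_monomial_mult)
qed

lemma good_mset: "good (mset w) \<longleftrightarrow> (\<forall>v\<in>set w. good_var v) \<and>
    (\<Sum>v\<leftarrow>w. gwt (vdeg v)) \<le> 1 \<and> (\<Sum>v\<leftarrow>w. hwt (vdeg v)) \<le> 1"
  by (simp add: good_def sum_mset_sum_list flip: mset_map)

lemma gens_subset_Id_sharp: "gens \<subseteq> Id_sharp (W_alg \<nu> g h)"
proof
  fix f assume f: "f \<in> gens"
  show "f \<in> Id_sharp (W_alg \<nu> g h)"
    unfolding W.Id_sharp_iff
  proof (intro allI impI)
    fix \<rho> assume \<rho>: "W.admissible \<rho>"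
    have val: "\<rho> (Var i k e) \<in> pm_cmp (W_alg \<nu> g h) k e" for i k e
      using \<rho> by (simp add: W.admissible_iff)
    have prod: "free_eval (W_alg \<nu> g h) \<rho> (X i k (sgn_of k) * X j l (sgn_of l)) = 0"
      if k: "k \<in> {0, g, h, g + h}" and l: "l \<in> {0, g, h, g + h}" and 2: "2 \<le> gwt k + gwt l \<or> 2 \<le> hwt k + hwt l" for i j k l
    proof -
      obtain a b where "\<rho> (Var i k (sgn_of k)) = mscale a (W_monomial (gwt k) (hwt k))"
          "\<rho> (Var j l (sgn_of l)) = mscale b (W_monomial (gwt l) (hwt l))"
        using val[of i k "sgn_of k"] val[of j l "sgn_of l"] k l unfolding pm_cmp_W
        by (auto simp: good_type_def)
      then show ?thesis
        by (simp add: W.free_eval_mult[OF \<rho>] W.free_eval_X[OF \<rho>] mscale_mult W_monomial_mult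
            W_monomial_eq_0[OF 2])
    qed
    show "free_eval (W_alg \<nu> g h) \<rho> f = 0"
      using f prod[of g g 0 1] prod[of h h 0 1] prod[of "g + h" "g + h" 0 1]
        prod[of g "g + h" 0 1] prod[of h "g + h" 0 1] val[of 0] W.free_eval_X[OF \<rho>]
      unfolding gens_def pm_cmp_W by auto
  qed
qed

text \<open>Evaluate at \<open>point x\<close> and read the matrix entry belonging to the pair of
  weights of \<open>M\<close>. What remains is a relation, valid for all \<open>x\<close>, between
  the commutative monomials of the good multisets with those weights, and
  \<open>monomials_independent\<close> applies.\<close>

lemma good_coeff_zero:
  assumes f: "f \<in> Id_sharp (W_alg \<nu> g h)" and M: "good M"
  shows "Poly_Mapping.lookup (pushforward mset f) M = 0"
proof -
  let ?K = "Poly_Mapping.keys f" and ?c = "Poly_Mapping.lookup f"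
  define i where "i = (\<Sum>v\<in>#M. gwt (vdeg v))"
  define j where "j = (\<Sum>v\<in>#M. hwt (vdeg v))"
  have ij: "i \<le> 1" "j \<le> 1" using M by (auto simp: good_def i_def j_def)
  \<comment> \<open>The column of the first row that holds the coordinate of the monomial with
    exponents \<open>i\<close> and \<open>j\<close>.\<close>
  define k :: 4 where "k = (if j = 0 then if i = 0 then 1 else 2 else if i = 0 then 3 else 4)"
  have k: "W_monomial a b $ 1 $ k = of_bool (a = i \<and> b = j)" for a b
    unfolding k_def by (rule W_monomial_entry[OF ij])
  define P where "P N \<longleftrightarrow> (\<forall>v\<in>#N. good_var v) \<and>
    (\<Sum>v\<in>#N. gwt (vdeg v)) = i \<and> (\<Sum>v\<in>#N. hwt (vdeg v)) = j" for N
  \<comment> \<open>Cutting off the other weights keeps the index set equal to the finite set of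
    multisets occurring in \<open>f\<close>.\<close>
  define C where "C N = (if P N then Poly_Mapping.lookup (pushforward mset f) N else 0)" for N
  have sum_zero: "(\<Sum>N\<in>mset ` ?K. C N * prod_mset (image_mset x N)) = 0" for x
  proof -
    have entry: "W.word_eval (point x) w $ 1 $ k = (if P (mset w) then prod_mset (image_mset x (mset w)) else 0)" for w
    proof -
      have "P (mset w) \<longleftrightarrow> (\<forall>v\<in>set w. good_var v) \<and>
          (\<Sum>v\<leftarrow>w. gwt (vdeg v)) = i \<and> (\<Sum>v\<leftarrow>w. hwt (vdeg v)) = j"
        by (simp add: P_def sum_mset_sum_list flip: mset_map)
      then show ?thesis
        unfolding word_eval_point
        by (auto simp: mscale_entry k prod_mset_prod_list simp flip: mset_map)
    qed
    have "0 = free_eval (W_alg \<nu> g h) (point x) f $ 1 $ k"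
      using f admissible_point by (simp add: W.Id_sharp_iff)
    also have "\<dots> = (\<Sum>w\<in>?K. ?c w * W.word_eval (point x) w $ 1 $ k)"
      by (simp add: free_eval_def sum_component mscale_entry W.word_eval_def)
    also have "\<dots> = (\<Sum>w\<in>?K. ?c w * (if P (mset w) then prod_mset (image_mset x (mset w)) else 0))"
      unfolding entry ..
    also have "\<dots> = (\<Sum>N\<in>mset ` ?K. \<Sum>w\<in>{w\<in>?K. mset w = N}.
        ?c w * (if P (mset w) then prod_mset (image_mset x (mset w)) else 0))"
      by (rule sum.image_gen) simp
    also have "\<dots> = (\<Sum>N\<in>mset ` ?K. C N * prod_mset (image_mset x N))"
      by (intro sum.cong refl) (simp add: C_def lookup_pushforward sum_distrib_right)
    finally show ?thesis by simp
  qed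
  have "P M" using M by (simp add: P_def i_def j_def good_def)
  then have "Poly_Mapping.lookup (pushforward mset f) M = 0" if "M \<in> mset ` ?K"
    using monomials_independent[OF _ sum_zero that] by (simp add: C_def)
  moreover have "Poly_Mapping.lookup (pushforward mset f) M = 0" if "M \<notin> mset ` ?K"
    unfolding lookup_pushforward by (rule sum.neutral) (use that in auto)
  ultimately show ?thesis by blast
qed

text \<open>One direction is generic evaluation; the other is the reduction applied to the ideal of
  identities itself.\<close>

theorem Id_sharp_W_iff:
  "f \<in> Id_sharp (W_alg \<nu> g h) \<longleftrightarrow>
    (\<forall>M. good M \<longrightarrow> Poly_Mapping.lookup (pushforward mset f) M = 0)"
  using good_coeff_zero mem_if_good_coeffs_zero[OF W.T_ideal_Id_sharp gens_subset_Id_sharp] by blast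

theorem Id_sharp_W: "Id_sharp (W_alg \<nu> g h) = T_ideal hull gens"
proof (rule hull_unique[symmetric])
  fix I assume "gens \<subseteq> I" "T_ideal I"
  then show "Id_sharp (W_alg \<nu> g h) \<subseteq> I"
    using mem_if_good_coeffs_zero good_coeff_zero by blast
qed (rule gens_subset_Id_sharp W.T_ideal_Id_sharp)+

end


text \<open>The index \<open>n\<close>, which lies outside the range, encodes the zero function, so
  that both cases have the same form.\<close>

lemma sum_le_1_nat:
  fixes f :: "nat \<Rightarrow> nat"
  assumes "(\<Sum>k<n. f k) \<le> 1"
  obtains i where "i \<le> n" "\<And>k. k < n \<Longrightarrow> f k = of_bool (k = i)"
proof (cases "\<exists>i<n. f i \<noteq> 0")
  case True
  then obtain i where i: "i < n" "f i \<noteq> 0" by blast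
  have sum: "(\<Sum>k<n. f k) = f i + (\<Sum>k\<in>{..<n} - {i}. f k)"
    using i(1) by (intro sum.remove) auto
  have "f i = 1" using sum i(2) assms by linarith
  moreover have "f k = 0" if "k < n" "k \<noteq> i" for k
  proof -
    have "(\<Sum>k\<in>{..<n} - {i}. f k) = 0" using sum i(2) assms by linarith
    then show ?thesis using that by simp
  qed
  ultimately show thesis using i(1) by (intro that[of i]) auto
next
  case False
  then show thesis by (intro that[of n]) auto
qed

section \<open>Bases of quotients spanned by words\<close>

context W_grading
begin

abbreviation "Id_W \<equiv> Id_sharp (W_alg \<nu> g h)"

text \<open>Shared by codimensions and cocharacters: representatives of the good multisets occurring
  in \<open>\<W>\<close> give a basis, because the coefficients of good multisets are coordinates
  modulo identities.\<close>

lemma basis_mod_words: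
  fixes \<W> :: "'g var list set" and R :: "'g var list set"
  defines "P \<equiv> pvs.span {Poly_Mapping.single w (1 :: 'f) | w. w \<in> \<W>}"
  assumes R: "finite R" "R \<subseteq> \<W>" "inj_on mset R" "\<And>w. w \<in> R \<Longrightarrow> good (mset w)"
    and cover: "\<And>w. w \<in> \<W> \<Longrightarrow> good (mset w) \<Longrightarrow> mset w \<in> mset ` R"
  shows "\<exists>B. basis_mod P (P \<inter> Id_W) B \<and> card B = card R"
proof -
  define e where "e w = Poly_Mapping.single w (1 :: 'f)" for w :: "'g var list"
  have inj: "inj e"
  proof (rule injI)
    fix u w assume "e u = e w"
    from arg_cong[OF this, of Poly_Mapping.keys] show "u = w" by (simp add: e_def)
  qed
  have P: "pvs.subspace P" unfolding P_def by (rule pvs.subspace_span)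
  have eP: "e w \<in> P" if "w \<in> \<W>" for w
    unfolding P_def e_def using that by (intro pvs.span_base) auto
  let ?L = "\<lambda>p. Poly_Mapping.lookup (pushforward mset p)"
  have P_lookup: "?L p M = 0" if "p \<in> P" "good M" "M \<notin> mset ` R" for p M
    using that(1) unfolding P_def
  proof (induction rule: pvs.span_induct_alt)
    case (step c x y)
    then obtain w where w: "x = Poly_Mapping.single w 1" "w \<in> \<W>" by blast
    then have "mset w \<noteq> M" using cover that(2,3) by blast
    then show ?case by (simp add: pushforward_linear lookup_add w(1) lookup_single step.IH)
  qed (simp add: pushforward_linear)
  have coord: "?L (\<Sum>b\<in>e ` R. pscale (c b) b) (mset w) = c (e w)" if "w \<in> R" for c w
  proof -
    have "?L (\<Sum>b\<in>e ` R. pscale (c b) b) (mset w) = (\<Sum>u\<in>R. ?L (pscale (c (e u)) (e u)) (mset w))"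
      using inj by (simp add: sum.reindex inj_on_subset[OF inj] pushforward_linear lookup_sum)
    also have "\<dots> = (\<Sum>u\<in>R. if u = w then c (e w) else 0)"
      using inj_onD[OF R(3) _ _ that] by (intro sum.cong) (auto simp: e_def lookup_single when_def)
    also have "\<dots> = c (e w)" using R(1) that by simp
    finally show ?thesis .
  qed
  \<comment> \<open>An explicit formula for the coordinates gives their existence and uniqueness
    together.\<close>
  have coords_iff: "is_coords_mod (P \<inter> Id_W) (e ` R) p c \<longleftrightarrow>
      c = (\<lambda>b. if b \<in> e ` R then ?L p (mset (inv e b)) else 0)" if "p \<in> P" for p c
  proof -
    let ?S = "\<Sum>b\<in>e ` R. pscale (c b) b"
    have "?S \<in> P" using R(2) eP by (intro pvs.subspace_sum[OF P] pvs.subspace_scale[OF P]) auto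
    then have pS: "p - ?S \<in> P" using that by (intro pvs.subspace_diff[OF P])
    have "p - ?S \<in> Id_W \<longleftrightarrow> (\<forall>M. good M \<longrightarrow> ?L p M = ?L ?S M)"
      unfolding Id_sharp_W_iff by (simp add: pushforward_linear lookup_minus)
    also have "\<dots> \<longleftrightarrow> (\<forall>w\<in>R. ?L p (mset w) = c (e w))"
    proof (intro iffI allI impI ballI)
      fix w assume "\<forall>M. good M \<longrightarrow> ?L p M = ?L ?S M" "w \<in> R"
      then show "?L p (mset w) = c (e w)" using coord[of w c] R(4)[of w] by simp
    next
      fix M assume eq: "\<forall>w\<in>R. ?L p (mset w) = c (e w)" and M: "good M"
      show "?L p M = ?L ?S M"
      proof (cases "M \<in> mset ` R")
        case True
        then obtain w where "w \<in> R" "M = mset w" by blast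
        then show ?thesis using eq coord[of w c] by simp
      next
        case False
        then show ?thesis using P_lookup[OF that M] P_lookup[OF \<open>?S \<in> P\<close> M] by simp
      qed
    qed
    finally show ?thesis
      unfolding is_coords_mod_def using pS inv_f_f[OF inj] by (auto simp: fun_eq_iff)
  qed
  have "basis_mod P (P \<inter> Id_W) (e ` R)"
    unfolding basis_mod_def using R(1,2) eP by (auto simp: coords_iff)
  moreover have "card (e ` R) = card R" by (intro card_image inj_on_subset[OF inj]) simp
  ultimately show ?thesis by blast
qed

lemma subspace_Id_W: "pvs.subspace Id_W"
  by (rule T_ideal_subspace[OF W.T_ideal_Id_sharp])


section \<open>Codimensions\<close>

text \<open>A good multilinear word is determined up to permutation by the positions of the variables
  with \<open>gwt\<close> and \<open>hwt\<close> equal to one, where position \<open>n\<close> stands for absence.\<close>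

definition pos_deg :: "nat \<Rightarrow> nat \<Rightarrow> nat \<Rightarrow> 'g"
  where "pos_deg i j k = (if k = i then g else 0) + (if k = j then h else 0)"

definition pos_word :: "nat \<Rightarrow> nat \<times> nat \<Rightarrow> 'g var list"
  where "pos_word n p =
    map (\<lambda>k. Var k (pos_deg (fst p) (snd p) k) (sgn_of (pos_deg (fst p) (snd p) k))) [0..<n]"

text \<open>All pairs of positions are allowed: if \<open>i = j\<close>, the two weights fall on one
  variable of degree \<open>g + h\<close>.\<close>

lemma pos_deg_weights:
  "pos_deg i j k \<in> {0, g, h, g + h}" "gwt (pos_deg i j k) = of_bool (k = i)"
  "hwt (pos_deg i j k) = of_bool (k = j)"
  by (simp_all add: pos_deg_def)

lemma degree_eqI:
  assumes "k \<in> {0, g, h, g + h}" "l \<in> {0, g, h, g + h}" "gwt k = gwt l" "hwt k = hwt l"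
  shows "k = l"
  using assms by (elim insertE emptyE) simp_all

lemma pos_word_props:
  "distinct (pos_word n p)" "map vnum (pos_word n p) = [0..<n]"
  "set (pos_word n p) =
    (\<lambda>k. Var k (pos_deg (fst p) (snd p) k) (sgn_of (pos_deg (fst p) (snd p) k))) ` {..<n}"
  by (auto simp: pos_word_def distinct_map inj_on_def o_def)

lemma good_pos_word: "good (mset (pos_word n p))"
proof -
  have sum: "(\<Sum>k\<leftarrow>[0..<n]. of_bool (k = i)) \<le> (1 :: nat)" for i
    using card_mono[of "{i}" "{0..<n} \<inter> {i}"] by (simp add: interv_sum_list_conv_sum_set_nat)
  show ?thesis
    unfolding good_mset using sum pos_deg_weights(1)
    by (auto simp: pos_word_def o_def pos_deg_weights(2,3) good_type_def)
qed

lemma inj_on_mset_pos_word: "inj_on (\<lambda>p. mset (pos_word n p)) ({..n} \<times> {..n})"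
proof (rule inj_onI)
  fix p q :: "nat \<times> nat"
  assume pq: "p \<in> {..n} \<times> {..n}" "q \<in> {..n} \<times> {..n}" and eq: "mset (pos_word n p) = mset (pos_word n q)"
  have "pos_deg (fst p) (snd p) k = pos_deg (fst q) (snd q) k" if "k < n" for k
    using arg_cong[OF eq, of set_mset] that unfolding set_mset_mset pos_word_props(3) by blast
  then have "gwt (pos_deg (fst p) (snd p) k) = gwt (pos_deg (fst q) (snd q) k)"
      "hwt (pos_deg (fst p) (snd p) k) = hwt (pos_deg (fst q) (snd q) k)" if "k < n" for k
    using that by simp_all
  then have k: "of_bool (k = fst p) = (of_bool (k = fst q) :: nat)"
      "of_bool (k = snd p) = (of_bool (k = snd q) :: nat)" if "k < n" for k
    using that unfolding pos_deg_weights(2,3) by blast+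
  \<comment> \<open>On the numbers below \<open>n\<close> the indicator of a position determines it,
    the zero indicator belonging to \<open>n\<close>.\<close>
  have eqI: "i = i'"
    if "\<And>k. k < n \<Longrightarrow> of_bool (k = i) = (of_bool (k = i') :: nat)" "i \<le> n" "i' \<le> n" for i i'
    using that(1)[of i] that(1)[of i'] that(2,3) unfolding of_bool_eq_iff by linarith
  have "fst p = fst q" "snd p = snd q" using pq eqI[OF k(1)] eqI[OF k(2)] by auto
  then show "p = q" by (simp add: prod_eq_iff)
qed

lemma pos_word_cover:
  assumes w: "distinct (map vnum w)" "set (map vnum w) = {..<n}" and good: "good (mset w)"
  shows "\<exists>p\<in>{..n} \<times> {..n}. mset w = mset (pos_word n p)"
proof -
  have inj: "inj_on vnum (set w)" and dist: "distinct w" using w(1) by (auto simp: distinct_map)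
  have gw: "\<And>v. v \<in> set w \<Longrightarrow> good_var v" "(\<Sum>v\<leftarrow>w. gwt (vdeg v)) \<le> 1" "(\<Sum>v\<leftarrow>w. hwt (vdeg v)) \<le> 1"
    using good by (auto simp: good_mset)
  \<comment> \<open>\<open>V k\<close> is the letter of \<open>w\<close> numbered \<open>k\<close>;
    numbering is injective on a multilinear word.\<close>
  define V where "V k = the_inv_into (set w) vnum k" for k
  have num: "vnum ` set w = {..<n}" using w(2) by simp
  have V: "V k \<in> set w" "vnum (V k) = k" if "k < n" for k
    using that inj num unfolding V_def
    by (auto intro: the_inv_into_into f_the_inv_into_f)
  have V_vnum: "V (vnum v) = v" if "v \<in> set w" for v
    using that inj by (simp add: V_def the_inv_into_f_f)
  have sum: "(\<Sum>v\<leftarrow>w. f (vdeg v)) = (\<Sum>k<n. f (vdeg (V k)))" for f :: "'g \<Rightarrow> nat"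
  proof -
    have "(\<Sum>v\<leftarrow>w. f (vdeg v)) = (\<Sum>v\<in>set w. f (vdeg v))"
      by (rule sum_list_distinct_conv_sum_set[OF dist])
    also have "\<dots> = (\<Sum>k\<in>vnum ` set w. f (vdeg (V k)))"
      by (simp add: sum.reindex[OF inj] V_vnum)
    finally show ?thesis by (simp add: num)
  qed
  obtain i where i: "i \<le> n" "\<And>k. k < n \<Longrightarrow> gwt (vdeg (V k)) = of_bool (k = i)"
    using sum_le_1_nat[of "\<lambda>k. gwt (vdeg (V k))" n] gw(2) unfolding sum by blast
  obtain j where j: "j \<le> n" "\<And>k. k < n \<Longrightarrow> hwt (vdeg (V k)) = of_bool (k = j)"
    using sum_le_1_nat[of "\<lambda>k. hwt (vdeg (V k))" n] gw(3) unfolding sum by blast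
  have "V k = Var k (pos_deg i j k) (sgn_of (pos_deg i j k))" if "k < n" for k
  proof -
    have "vdeg (V k) = pos_deg i j k"
      using gw(1)[OF V(1)[OF that]] i(2)[OF that] j(2)[OF that] pos_deg_weights[of i j k]
      by (intro degree_eqI) (auto simp: good_type_def)
    then show ?thesis
      using gw(1)[OF V(1)[OF that]] V(2)[OF that] by (cases "V k") (simp add: good_type_def)
  qed
  moreover have "set w = V ` {..<n}"
    using V_vnum by (simp add: image_image flip: num)
  ultimately have "set w = set (pos_word n (i, j))" by (simp add: pos_word_props(3))
  then have "mset w = mset (pos_word n (i, j))"
    using dist pos_word_props(1) set_eq_iff_mset_eq_distinct by blast
  then show ?thesis using i(1) j(1) by (intro bexI[of _ "(i, j)"]) auto
qed

theorem codim_W: "codim (W_alg \<nu> g h) n = 1 + 3 * n + 2 * (n choose 2)"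
proof -
  let ?W = "{w :: 'g var list. length w = n \<and> distinct (map vnum w) \<and> set (map vnum w) = {..<n}}"
  let ?R = "pos_word n ` ({..n} \<times> {..n})"
  have P: "P_sharp n = pvs.span {Poly_Mapping.single w (1 :: 'f) | w. w \<in> ?W}"
    by (simp add: P_sharp_def)
  have inj: "inj_on (pos_word n) ({..n} \<times> {..n})"
    using inj_on_mset_pos_word[of n] by (auto simp: inj_on_def)
  have "\<exists>B. basis_mod (P_sharp n) (P_sharp n \<inter> Id_W) B \<and> card B = card ?R"
    unfolding P
  proof (rule basis_mod_words)
    show "?R \<subseteq> ?W"
    proof clarify
      fix i j
      show "length (pos_word n (i, j)) = n \<and> distinct (map vnum (pos_word n (i, j))) \<and>
          set (map vnum (pos_word n (i, j))) = {..<n}"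
        unfolding pos_word_props(2) by (auto simp: pos_word_def)
    qed
    show "inj_on mset ?R"
      using inj_on_mset_pos_word[of n] by (auto simp: inj_on_def)
    show "mset w \<in> mset ` ?R" if "w \<in> ?W" "good (mset w)" for w
      using pos_word_cover[of w n] that by auto
  qed (auto intro: good_pos_word)
  then obtain B where B: "basis_mod (P_sharp n) (P_sharp n \<inter> Id_W) B" "card B = card ?R" by blast
  have "codim (W_alg \<nu> g h) n = card B"
    unfolding codim_def
    by (rule quot_dim_eq[OF _ _ B(1)])
      (auto simp: P_sharp_def intro: pvs.subspace_inter subspace_Id_W)
  also have "\<dots> = (n + 1) * (n + 1)"
    unfolding B(2) card_image[OF inj] by (simp add: card_cartesian_product)
  \<comment> \<open>Expand the square and use that twice the binomial coefficient is
    \<open>n * (n - 1)\<close>.\<close>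
  also have "\<dots> = 1 + 3 * n + 2 * (n choose 2)"
  proof -
    have "2 * (n choose 2) = n * (n - 1)" unfolding choose_two by (intro dvd_mult_div_cancel) auto
    then show ?thesis by (cases n) (simp_all add: algebra_simps)
  qed
  finally show ?thesis .
qed


section \<open>Cocharacters\<close>

definition type_vars :: "('g \<times> pm \<Rightarrow> nat) \<Rightarrow> 'g var set"
  where "type_vars \<mu> = {Var i k e | i k e. i < \<mu> (k, e)}"

definition good_tuple :: "('g \<times> pm \<Rightarrow> nat) \<Rightarrow> bool"
  where "good_tuple \<mu> \<longleftrightarrow> (\<forall>p. \<not> good_type p \<longrightarrow> \<mu> p = 0) \<and>
    \<mu> (g, s) + \<mu> (g + h, pm_times s t) \<le> 1 \<and> \<mu> (h, t) + \<mu> (g + h, pm_times s t) \<le> 1"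

lemma type_vars_image:
  "type_vars \<mu> = (\<lambda>(p, i). Var i (fst p) (snd p)) ` (SIGMA p:UNIV. {..<\<mu> p})"
  by (auto simp: type_vars_def image_iff)

lemma finite_type_vars: "finite (type_vars \<mu>)"
  unfolding type_vars_image by (intro finite_imageI finite_SigmaI) auto

lemma good_types:
  "{p. good_type p} = {(0, Plus), (g, s), (h, t), (g + h, pm_times s t)}"
  by (auto simp: good_type_def)

lemma sum_good_types:
  fixes f :: "'g \<times> pm \<Rightarrow> nat"
  assumes "\<And>p. \<not> good_type p \<Longrightarrow> f p = 0"
  shows "(\<Sum>p\<in>UNIV. f p) = f (0, Plus) + f (g, s) + f (h, t) + f (g + h, pm_times s t)"
proof -
  have "(\<Sum>p\<in>UNIV. f p) = (\<Sum>p\<in>{p. good_type p}. f p)"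
    using assms by (intro sum.mono_neutral_right) auto
  also have "\<dots> = f (0, Plus) + f (g, s) + f (h, t) + f (g + h, pm_times s t)"
    unfolding good_types by simp
  finally show ?thesis .
qed

text \<open>All words of a multilinear component have the same letters, so goodness depends on
  \<open>\<mu>\<close> alone; counting letters by type turns the weight sums into the bounds of
  \<open>good_tuple\<close>.\<close>

lemma good_type_vars:
  assumes w: "distinct w" "set w = type_vars \<mu>"
  shows "good (mset w) \<longleftrightarrow> good_tuple \<mu>"
proof -
  have sum: "(\<Sum>v\<leftarrow>w. f (vdeg v)) = (\<Sum>p\<in>UNIV. \<mu> p * f (fst p))" for f :: "'g \<Rightarrow> nat"
  proof -
    have "(\<Sum>v\<leftarrow>w. f (vdeg v)) = (\<Sum>v\<in>type_vars \<mu>. f (vdeg v))"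
      using sum_list_distinct_conv_sum_set[OF w(1)] w(2) by simp
    also have "\<dots> = (\<Sum>(p, i)\<in>(SIGMA p:UNIV. {..<\<mu> p}). f (fst p))"
      unfolding type_vars_image by (subst sum.reindex) (auto simp: inj_on_def split_def)
    also have "\<dots> = (\<Sum>p\<in>UNIV. \<mu> p * f (fst p))"
      by (subst sum.Sigma[symmetric]) auto
    finally show ?thesis .
  qed
  have "(\<forall>v\<in>set w. good_var v) \<longleftrightarrow> (\<forall>p. \<not> good_type p \<longrightarrow> \<mu> p = 0)"
    unfolding w(2) type_vars_def by fastforce
  moreover have "(\<Sum>p\<in>UNIV. \<mu> p * gwt (fst p)) = \<mu> (g, s) + \<mu> (g + h, pm_times s t)"
    "(\<Sum>p\<in>UNIV. \<mu> p * hwt (fst p)) = \<mu> (h, t) + \<mu> (g + h, pm_times s t)"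
    if "\<forall>p. \<not> good_type p \<longrightarrow> \<mu> p = 0"
    using that sum_good_types[of "\<lambda>p. \<mu> p * gwt (fst p)"] sum_good_types[of "\<lambda>p. \<mu> p * hwt (fst p)"]
    by (simp_all del: split_paired_All)
  ultimately show ?thesis
    unfolding good_mset good_tuple_def sum by auto
qed

lemma rename_var_type_vars:
  assumes "\<sigma> \<in> sym_prod \<mu>"
  shows "inj (rename_var \<sigma>)" "rename_var \<sigma> ` type_vars \<mu> = type_vars \<mu>"
proof -
  have \<sigma>: "\<sigma> p permutes {..<\<mu> p}" for p using assms by (simp add: sym_prod_def del: split_paired_All)
  show "inj (rename_var \<sigma>)"
  proof (rule injI)
    fix u v assume "rename_var \<sigma> u = rename_var \<sigma> v"
    then show "u = v"
      using permutes_inj[OF \<sigma>] by (auto simp: rename_var_def inj_eq intro: var.expand)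
  qed
  have "rename_var \<sigma> ` type_vars \<mu> \<subseteq> type_vars \<mu>"
    using permutes_in_image[OF \<sigma>] by (auto simp: type_vars_def rename_var_def)
  then show "rename_var \<sigma> ` type_vars \<mu> = type_vars \<mu>"
    using finite_type_vars \<open>inj (rename_var \<sigma>)\<close>
    by (intro card_subset_eq) (auto simp: card_image inj_on_subset)
qed

text \<open>The component contains one multiset of letters, so the quotient is a line or zero.
  Renaming replaces a word by another with the same letters, congruent to it modulo identities, so
  the action is trivial; the trivial character is the one-row character.\<close>

theorem cochar_W: "cochar (W_alg \<nu> g h) \<mu> =
    (if good_tuple \<mu> then outer_char (\<lambda>p. one_row (\<mu> p)) else (\<lambda>_. 0))"
proof
  fix \<sigma>
  let ?W = "{w :: 'g var list. distinct w \<and> set w = type_vars \<mu>}"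
  have P: "P_type \<mu> = pvs.span {Poly_Mapping.single w (1 :: 'f) | w. w \<in> ?W}"
    by (simp add: P_type_def type_vars_def)
  have sub: "pvs.subspace (P_type \<mu> :: ('f, 'g) free set)" unfolding P by (rule pvs.subspace_span)
  have same: "mset w = mset w'" if "w \<in> ?W" "w' \<in> ?W" for w w'
    using that set_eq_iff_mset_eq_distinct[of w w'] by auto
  obtain w0 where w0: "w0 \<in> ?W"
    using finite_distinct_list[OF finite_type_vars] by blast
  define R where "R = (if good_tuple \<mu> then {w0} else {})"
  have "\<exists>B. basis_mod (P_type \<mu>) (P_type \<mu> \<inter> Id_W) B \<and> card B = card R"
    unfolding P
  proof (rule basis_mod_words)
    show "R \<subseteq> ?W" "inj_on mset R" using w0 by (auto simp: R_def)
    show "good (mset w)" if "w \<in> R" for w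
      using that w0 good_type_vars[of w0 \<mu>] by (simp add: R_def split: if_splits)
    show "mset w \<in> mset ` R" if "w \<in> ?W" "good (mset w)" for w
      using that good_type_vars[of w \<mu>] same[OF that(1) w0] by (simp add: R_def)
  qed (simp add: R_def)
  then obtain B where B: "basis_mod (P_type \<mu>) (P_type \<mu> \<inter> Id_W) B" "card B = card R" by blast
  have trace: "quot_trace (P_type \<mu>) (P_type \<mu> \<inter> Id_W) (pushforward (map (rename_var \<sigma>))) = of_nat (card B)"
    if \<sigma>: "\<sigma> \<in> sym_prod \<mu>"
  proof (rule quot_trace_eq[OF sub _ _ B(1)])
    let ?T = "pushforward (map (rename_var \<sigma>)) :: ('f, 'g) free \<Rightarrow> _"
    note subQ = pvs.subspace_inter[OF sub subspace_Id_W]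
    show "pvs.subspace (P_type \<mu> \<inter> Id_W)" by (rule subQ)
    fix p :: "('f, 'g) free" assume "p \<in> P_type \<mu>"
    then show "?T p - p \<in> P_type \<mu> \<inter> Id_W"
      unfolding P
    proof (induction rule: pvs.span_induct_alt)
      case base
      show ?case using pvs.subspace_0[OF subQ] by (simp add: pushforward_linear P)
    next
      case (step c x y)
      then obtain w where w: "x = Poly_Mapping.single w 1" "w \<in> ?W" by blast
      have w': "map (rename_var \<sigma>) w \<in> ?W"
        using w(2) rename_var_type_vars[OF \<sigma>] inj_on_subset[OF _ subset_UNIV]
        by (auto simp: distinct_map)
      have "?T x - x \<in> P_type \<mu>"
        unfolding P w(1) pushforward_single using w(2) w'
        by (intro pvs.span_diff pvs.span_base) auto
      moreover have "?T x - x \<in> Id_W"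
        unfolding Id_sharp_W_iff
        by (simp add: w(1) pushforward_linear lookup_minus same[OF w' w(2)] del: mset_map)
      ultimately have "pscale c (?T x - x) + (?T y - y) \<in> P_type \<mu> \<inter> Id_W"
        using step.IH by (intro pvs.subspace_add[OF subQ] pvs.subspace_scale[OF subQ]) (auto simp: P)
      also have "pscale c (?T x - x) + (?T y - y) = ?T (pscale c x + y) - (pscale c x + y)"
        by (simp add: pushforward_linear pvs.scale_right_diff_distrib)
      finally show ?case by (simp add: P)
    qed
  qed auto
  show "cochar (W_alg \<nu> g h) \<mu> \<sigma> =
      (if good_tuple \<mu> then outer_char (\<lambda>p. one_row (\<mu> p)) else (\<lambda>_. 0)) \<sigma>"
    by (auto simp: cochar_def trace B(2) R_def outer_char_one_row)
qed

lemma cochar_W_nonzero: "cochar (W_alg \<nu> g h) \<mu> \<noteq> (\<lambda>_. 0) \<longleftrightarrow> good_tuple \<mu>"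
proof -
  have "outer_char (\<lambda>p. one_row (\<mu> p)) (\<lambda>_. id) = (1 :: 'f)"
    by (simp add: outer_char_one_row id_sym_prod)
  then have "outer_char (\<lambda>p. one_row (\<mu> p)) \<noteq> (\<lambda>_. 0 :: 'f)" by (metis zero_neq_one)
  then show ?thesis by (simp add: cochar_W)
qed

section \<open>The five good tuples, cocharacter sequence and colength\<close>

definition tuples :: "nat \<Rightarrow> ('g \<times> pm \<Rightarrow> nat) set"
  where "tuples n = {(\<lambda>_. 0)((0, Plus) := n),
    (\<lambda>_. 0)((0, Plus) := n - 1, (g, s) := 1),
    (\<lambda>_. 0)((0, Plus) := n - 1, (h, t) := 1),
    (\<lambda>_. 0)((0, Plus) := n - 1, (g + h, pm_times s t) := 1),
    (\<lambda>_. 0)((0, Plus) := n - 2, (g, s) := 1, (h, t) := 1)}"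

text \<open>The number of variables of degree 0 is determined by \<open>n\<close> and the other
  three numbers. The bound on \<open>n\<close> makes the truncated \<open>n - 2\<close>
  exact.\<close>

lemma good_tuples:
  assumes "2 \<le> n"
  shows "{\<mu> \<in> types_of_size n. good_tuple \<mu>} = tuples n"
proof (intro equalityI subsetI)
  fix \<mu> assume "\<mu> \<in> {\<mu> \<in> types_of_size n. good_tuple \<mu>}"
  then have \<mu>: "\<And>p. \<not> good_type p \<Longrightarrow> \<mu> p = 0" "(\<Sum>p\<in>UNIV. \<mu> p) = n"
      "\<mu> (g, s) + \<mu> (g + h, pm_times s t) \<le> 1" "\<mu> (h, t) + \<mu> (g + h, pm_times s t) \<le> 1"
    by (auto simp: types_of_size_def good_tuple_def)
  have size: "\<mu> (0, Plus) + \<mu> (g, s) + \<mu> (h, t) + \<mu> (g + h, pm_times s t) = n"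
    using \<mu>(2) sum_good_types[OF \<mu>(1)] by simp
  have \<mu>_eq: "\<mu> = (\<lambda>_. 0)((0, Plus) := \<mu> (0, Plus), (g, s) := \<mu> (g, s), (h, t) := \<mu> (h, t),
      (g + h, pm_times s t) := \<mu> (g + h, pm_times s t))"
    using \<mu>(1) good_types by (fastforce simp: fun_eq_iff)
  \<comment> \<open>A variable of degree \<open>g + h\<close> uses up both weights; otherwise the
    degrees \<open>g\<close> and \<open>h\<close> each occur at most once, independently.\<close>
  consider "\<mu> (g, s) = 0" "\<mu> (h, t) = 0" "\<mu> (g + h, pm_times s t) = 0"
    | "\<mu> (g, s) = 1" "\<mu> (h, t) = 0" "\<mu> (g + h, pm_times s t) = 0"
    | "\<mu> (g, s) = 0" "\<mu> (h, t) = 1" "\<mu> (g + h, pm_times s t) = 0"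
    | "\<mu> (g, s) = 0" "\<mu> (h, t) = 0" "\<mu> (g + h, pm_times s t) = 1"
    | "\<mu> (g, s) = 1" "\<mu> (h, t) = 1" "\<mu> (g + h, pm_times s t) = 0"
    using \<mu>(3,4) by linarith
  then show "\<mu> \<in> tuples n"
    using size by cases (subst \<mu>_eq, force simp: tuples_def fun_eq_iff)+
next
  fix \<mu> assume \<mu>: "\<mu> \<in> tuples n"
  have bad: "\<mu> p = 0" if "\<not> good_type p" for p
  proof -
    have "p \<notin> {(0, Plus), (g, s), (h, t), (g + h, pm_times s t)}"
      using that good_types by blast
    then show ?thesis using \<mu> unfolding tuples_def by (elim insertE emptyE) simp_all
  qed
  show "\<mu> \<in> {\<mu> \<in> types_of_size n. good_tuple \<mu>}"
    using \<mu> bad assms sum_good_types[OF bad]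
    by (auto simp: types_of_size_def good_tuple_def tuples_def)
qed

theorem cochar_seq_eq_W:
  assumes "2 \<le> n"
  shows "cochar_seq_eq (W_alg \<nu> g h) n ((\<lambda>\<mu> p. one_row (\<mu> p)) ` tuples n)"
proof -
  have "{(\<mu>, cochar (W_alg \<nu> g h) \<mu>) | \<mu>. \<mu> \<in> types_of_size n \<and> cochar (W_alg \<nu> g h) \<mu> \<noteq> (\<lambda>_. 0)} =
      {(\<mu>, outer_char (\<lambda>p. one_row (\<mu> p))) | \<mu>. \<mu> \<in> tuples n}"
    unfolding cochar_W_nonzero good_tuples[OF assms, symmetric] by (auto simp: cochar_W)
  also have "\<dots> = {((\<lambda>p. sum_list (\<Lambda> p)), outer_char \<Lambda>) | \<Lambda>. \<Lambda> \<in> (\<lambda>\<mu> p. one_row (\<mu> p)) ` tuples n}"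
    by (simp add: setcompr_eq_image image_image)
  finally show ?thesis unfolding cochar_seq_eq_def .
qed

lemma card_tuples:
  assumes "2 \<le> n"
  shows "card (tuples n) = 5"
proof -
  \<comment> \<open>The three numbers outside degree 0 already separate the five tuples, which gives
    the lower bound.\<close>
  let ?f = "\<lambda>\<mu> :: 'g \<times> pm \<Rightarrow> nat. (\<mu> (g, s), \<mu> (h, t), \<mu> (g + h, pm_times s t))"
  have "?f ` tuples n = {(0, 0, 0), (1, 0, 0), (0, 1, 0), (0, 0, 1), (1, 1, 0)}"
    by (simp add: tuples_def)
  then have "card (?f ` tuples n) = 5" by simp
  moreover have "card (?f ` tuples n) \<le> card (tuples n)"
    by (rule card_image_le) (simp add: tuples_def)
  moreover have "card (tuples n) \<le> 5"
    unfolding tuples_def by (intro card_insert_le_m1) auto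
  ultimately show ?thesis by linarith
qed

lemma finite_types_of_size: "finite (types_of_size n :: ('g \<times> pm \<Rightarrow> nat) set)"
proof (rule finite_subset)
  have "\<mu> p \<le> n" if "(\<Sum>p\<in>UNIV. \<mu> p) = n" for \<mu> :: "'g \<times> pm \<Rightarrow> nat" and p
    using member_le_sum[of p UNIV \<mu>] that by simp
  then show "types_of_size n \<subseteq> PiE (UNIV :: ('g \<times> pm) set) (\<lambda>_. {..n})"
    by (auto simp: types_of_size_def)
  show "finite (PiE (UNIV :: ('g \<times> pm) set) (\<lambda>_. {..n}))" by (rule finite_PiE) auto
qed

theorem colength_W:
  assumes "2 \<le> n"
  shows "colength (W_alg \<nu> g h) n = 5"
proof -
  have "colength (W_alg \<nu> g h) n = (\<Sum>\<mu>\<in>types_of_size n. if good_tuple \<mu> then 1 else 0)"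
    unfolding colength_def
    by (intro sum.cong) (simp_all add: cochar_W num_constituents_zero num_constituents_one_row)
  also have "\<dots> = card {\<mu> \<in> types_of_size n. good_tuple \<mu>}"
    by (simp add: finite_types_of_size sum.If_cases Int_def)
  finally show ?thesis by (simp add: good_tuples[OF assms] card_tuples[OF assms])
qed

text \<open>The linear generators in explicit form: in each degree of the support exactly one sign
  is bad, and \<open>pm_times Minus\<close> produces it as the opposite of the good sign.\<close>

lemma gens_eq:
  "gens = {X 0 0 Minus, X 0 g (pm_times Minus s), X 0 h (pm_times Minus t),
      X 0 (g + h) (pm_times Minus (pm_times s t)),
      X 0 g s * X 1 g s, X 0 h t * X 1 h t,
      X 0 (g + h) (pm_times s t) * X 1 (g + h) (pm_times s t),
      X 0 g s * X 1 (g + h) (pm_times s t), X 0 h t * X 1 (g + h) (pm_times s t)} \<union>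
    {X 0 r e | r e. r \<notin> {0, g, h, g + h}}"
proof -
  have neq: "e \<noteq> d \<longleftrightarrow> e = pm_times Minus d" for d e by (cases d; cases e) simp_all
  have "\<not> good_type (k, e) \<longleftrightarrow> k = 0 \<and> e = Minus \<or> k = g \<and> e = pm_times Minus s \<or>
      k = h \<and> e = pm_times Minus t \<or> k = g + h \<and> e = pm_times Minus (pm_times s t) \<or>
      k \<notin> {0, g, h, g + h}" for k e
  proof -
    consider "k = 0" | "k = g" | "k = h" | "k = g + h" | "k \<notin> {0, g, h, g + h}" by blast
    then show ?thesis by cases (simp_all add: good_type_def neq)
  qed
  then have "{X 0 k e | k e. \<not> good_type (k, e)} = {X 0 k e | k e. k = 0 \<and> e = Minus \<or>
      k = g \<and> e = pm_times Minus s \<or> k = h \<and> e = pm_times Minus t \<or>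
      k = g + h \<and> e = pm_times Minus (pm_times s t) \<or> k \<notin> {0, g, h, g + h}}"
    by simp
  also have "\<dots> = {X 0 0 Minus, X 0 g (pm_times Minus s), X 0 h (pm_times Minus t),
       X 0 (g + h) (pm_times Minus (pm_times s t))} \<union> {X 0 r e | r e. r \<notin> {0, g, h, g + h}}"
    by blast
  finally show ?thesis unfolding gens_def by blast
qed

end

theorem lemma4p14:
  fixes g h :: "'g::{finite,ab_group_add}"
  assumes "g \<noteq> 0" "h \<noteq> 0" "g \<noteq> h" "g + h \<noteq> 0"
  shows
    "Id_sharp (W_alg nu1 g h :: ('f::field_char_0, 'g, 'f mat4) gstar_alg) = T_ideal hull
       ({X 0 0 Minus, X 0 g Plus * X 1 (g + h) Plus, X 0 h Plus * X 1 (g + h) Plus}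
        \<union> {X 0 s Minus | s. s \<in> {g, h, g + h}}
        \<union> {X 0 s Plus * X 1 s Plus | s. s \<in> {g, h, g + h}}
        \<union> {X 0 r \<epsilon> | r \<epsilon>. r \<notin> {0, g, h, g + h}})
     \<and>
     Id_sharp (W_alg nu2 g h :: ('f, 'g, 'f mat4) gstar_alg) = T_ideal hull
       ({X 0 0 Minus, X 0 g Plus, X 0 h Plus, X 0 (g + h) Minus,
         X 0 g Minus * X 1 g Minus, X 0 h Minus * X 1 h Minus,
         X 0 (g + h) Plus * X 1 (g + h) Plus,
         X 0 g Minus * X 1 (g + h) Plus, X 0 h Minus * X 1 (g + h) Plus}
        \<union> {X 0 r \<epsilon> | r \<epsilon>. r \<notin> {0, g, h, g + h}})
     \<and>
     Id_sharp (W_alg nu3 g h :: ('f, 'g, 'f mat4) gstar_alg) = T_ideal hull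
       ({X 0 0 Minus, X 0 g Plus, X 0 h Minus, X 0 (g + h) Plus,
         X 0 g Minus * X 1 g Minus, X 0 h Plus * X 1 h Plus,
         X 0 (g + h) Minus * X 1 (g + h) Minus,
         X 0 g Minus * X 1 (g + h) Minus, X 0 h Plus * X 1 (g + h) Minus}
        \<union> {X 0 r \<epsilon> | r \<epsilon>. r \<notin> {0, g, h, g + h}})
     \<and>
     (\<forall>n\<ge>2.
       cochar_seq_eq (W_alg nu1 g h :: ('f, 'g, 'f mat4) gstar_alg) n
         {no_parts((0, Plus) := one_row n),
          no_parts((0, Plus) := one_row (n - 1), (g, Plus) := one_row 1),
          no_parts((0, Plus) := one_row (n - 1), (h, Plus) := one_row 1),
          no_parts((0, Plus) := one_row (n - 1), (g + h, Plus) := one_row 1),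
          no_parts((0, Plus) := one_row (n - 2), (g, Plus) := one_row 1, (h, Plus) := one_row 1)}
       \<and>
       cochar_seq_eq (W_alg nu2 g h :: ('f, 'g, 'f mat4) gstar_alg) n
         {no_parts((0, Plus) := one_row n),
          no_parts((0, Plus) := one_row (n - 1), (g, Minus) := one_row 1),
          no_parts((0, Plus) := one_row (n - 1), (h, Minus) := one_row 1),
          no_parts((0, Plus) := one_row (n - 1), (g + h, Plus) := one_row 1),
          no_parts((0, Plus) := one_row (n - 2), (g, Minus) := one_row 1, (h, Minus) := one_row 1)}
       \<and>
       cochar_seq_eq (W_alg nu3 g h :: ('f, 'g, 'f mat4) gstar_alg) n
         {no_parts((0, Plus) := one_row n),
          no_parts((0, Plus) := one_row (n - 1), (g, Minus) := one_row 1),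
          no_parts((0, Plus) := one_row (n - 1), (h, Plus) := one_row 1),
          no_parts((0, Plus) := one_row (n - 1), (g + h, Minus) := one_row 1),
          no_parts((0, Plus) := one_row (n - 2), (g, Minus) := one_row 1, (h, Plus) := one_row 1)}
       \<and>
       (\<forall>\<nu>\<in>{nu1, nu2, nu3}.
          codim (W_alg \<nu> g h :: ('f, 'g, 'f mat4) gstar_alg) n = 1 + 3 * n + 2 * (n choose 2) \<and>
          colength (W_alg \<nu> g h :: ('f, 'g, 'f mat4) gstar_alg) n = 5))"
proof -
  interpret nu1: W_grading g h Plus Plus "nu1 :: 'f mat4 \<Rightarrow> 'f mat4"
    using assms by unfold_locales (simp_all add: nu_W_elt)
  interpret nu2: W_grading g h Minus Minus "nu2 :: 'f mat4 \<Rightarrow> 'f mat4"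
    using assms by unfold_locales (simp_all add: nu_W_elt)
  interpret nu3: W_grading g h Minus Plus "nu3 :: 'f mat4 \<Rightarrow> 'f mat4"
    using assms by unfold_locales (simp_all add: nu_W_elt)
  have gens1: "nu1.gens = {X 0 0 Minus, X 0 g Plus * X 1 (g + h) Plus, X 0 h Plus * X 1 (g + h) Plus}
        \<union> {X 0 s Minus | s. s \<in> {g, h, g + h}}
        \<union> {X 0 s Plus * X 1 s Plus | s. s \<in> {g, h, g + h}}
        \<union> {X 0 r \<epsilon> | r \<epsilon>. r \<notin> {0, g, h, g + h}}"
  proof -
    have "{f s | s. s \<in> {a, b, c}} = {f a, f b, f c}" for f :: "'g \<Rightarrow> ('f, 'g) free" and a b c
      by blast
    then show ?thesis
      unfolding nu1.gens_eq pm_times.simps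
      by (simp only: Un_insert_left Un_insert_right Un_empty_left Un_empty_right insert_commute)
  qed
  have gens2: "nu2.gens = {X 0 0 Minus, X 0 g Plus, X 0 h Plus, X 0 (g + h) Minus,
         X 0 g Minus * X 1 g Minus, X 0 h Minus * X 1 h Minus,
         X 0 (g + h) Plus * X 1 (g + h) Plus,
         X 0 g Minus * X 1 (g + h) Plus, X 0 h Minus * X 1 (g + h) Plus}
        \<union> {X 0 r \<epsilon> | r \<epsilon>. r \<notin> {0, g, h, g + h}}"
    unfolding nu2.gens_eq pm_times.simps ..
  have gens3: "nu3.gens = {X 0 0 Minus, X 0 g Plus, X 0 h Minus, X 0 (g + h) Plus,
         X 0 g Minus * X 1 g Minus, X 0 h Plus * X 1 h Plus,
         X 0 (g + h) Minus * X 1 (g + h) Minus,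
         X 0 g Minus * X 1 (g + h) Minus, X 0 h Plus * X 1 (g + h) Minus}
        \<union> {X 0 r \<epsilon> | r \<epsilon>. r \<notin> {0, g, h, g + h}}"
    unfolding nu3.gens_eq pm_times.simps ..
  \<comment> \<open>Turns tuples of numbers into tuples of partitions, one update at a time;
    \<open>zero\<close> takes care of the types that do not occur.\<close>
  have upd: "(\<lambda>p. one_row ((f(q := m)) p)) = (\<lambda>p. one_row (f p))(q := one_row m)"
    for f :: "'g \<times> pm \<Rightarrow> nat" and q m by auto
  have zero: "(\<lambda>p :: 'g \<times> pm. one_row 0) = no_parts" by (simp add: one_row_def)
  note tuples = image_insert image_empty upd zero pm_times.simps
  have dims: "\<forall>\<nu>\<in>{nu1, nu2, nu3}.
      codim (W_alg \<nu> g h :: ('f, 'g, 'f mat4) gstar_alg) n = 1 + 3 * n + 2 * (n choose 2) \<and>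
      colength (W_alg \<nu> g h :: ('f, 'g, 'f mat4) gstar_alg) n = 5" if "2 \<le> n" for n
    using that by (simp add: nu1.codim_W nu2.codim_W nu3.codim_W
        nu1.colength_W nu2.colength_W nu3.colength_W)
  note cochar = nu1.cochar_seq_eq_W[unfolded nu1.tuples_def tuples]
    nu2.cochar_seq_eq_W[unfolded nu2.tuples_def tuples]
    nu3.cochar_seq_eq_W[unfolded nu3.tuples_def tuples]
  note ids = nu1.Id_sharp_W[unfolded gens1] nu2.Id_sharp_W[unfolded gens2]
    nu3.Id_sharp_W[unfolded gens3]
  show ?thesis
    by (intro conjI allI impI) (rule ids cochar dims | assumption)+
qed

end
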